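(* Let $m=p+q$, write $\mathbb R^m=\mathbb R^p\oplus\mathbb R^q$, $x=u+v$ with $u\in\mathbb R^p$, $v\in\mathbb R^q$, and let $n\in\mathbb N$. For $k,i\in\mathbb N$ let $\{S_{k,l}(u):l=1,\dots,\dim\mathcal H_k(\mathbb R^p)\}$ be an orthonormal basis of $\mathcal H_k(\mathbb R^p)$ and $\{Q_{i,j}(v):j=1,\dots,\dim\mathcal H_i(\mathbb R^q)\}$ an orthonormal basis of $\mathcal H_i(\mathbb R^q)$. Then the polynomials $$P_H\big(|u|^{2s}S_{k,l}(u)Q_{i,j}(v)\big),\quad s,k,i\in\mathbb N,\ 2s+k+i=n,\ l=1,\dots,\dim\mathcal H_k(\mathbb R^p),\ j=1,\dots,\dim\mathcal H_i(\mathbb R^q),$$ determine an orthogonal basis of $\mathcal H_n(\mathbb R^m)$, and the basis elements are eigenfunctions of the three commuting Laplace–Beltrami (or Casimir) operators $\Delta_{LB,p}$, $\Delta_{LB,q}$, $\Delta_{LB,m}$ with respective eigenvalues $$-k(k+p-2),\qquad -i(i+q-2),\qquad -(2s+k+i)(2s+k+i+m-2)=-n(n+m-2),$$ which determine the labels $(s,k,i)$ in a unique way.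
   Context: $\mathbb N=\{0,1,2,\dots\}$. $\mathcal P(\mathbb R^d)$ is the space of complex-valued polynomials on $\mathbb R^d$, $\mathcal H(\mathbb R^d)$ its subspace of harmonic polynomials and $\mathcal H_k(\mathbb R^d)$ the space of harmonic polynomials homogeneous of degree $k$. $P_H:\mathcal P(\mathbb R^m)\to\mathcal H(\mathbb R^m)$ is the harmonic projection, i.e. the projection onto the $s=0$ summand of the (Fischer) decomposition $\mathcal P(\mathbb R^m)=\bigoplus_{s\ge0}|x|^{2s}\mathcal H(\mathbb R^m)$. Orthonormality and orthogonality are with respect to the Fischer inner products: on $\mathcal P(\mathbb R^d)$, $\langle P,Q\rangle_d=\overline P(\partial_x)Q(x)|_{x=0}$, where $\overline P$ is $P$ with complex conjugated coefficients and each variable $x_j$ is replaced by $\partial_{x_j}$. With $L_{ab}=x_a\partial_{x_b}-x_b\partial_{x_a}$, and $x_1,\dots,x_p$ the coordinates of $u$, $x_{p+1},\dots,x_m$ those of $v$: $\Delta_{LB,m}=\sum_{1\le a<b\le m}L_{ab}^2$, $\Delta_{LB,p}=\sum_{1\le a<b\le p}L_{ab}^2$, $\Delta_{LB,q}=\sum_{p<a<b\le m}L_{ab}^2$.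
   Formalization: Assumes p,q ≥ 1 (else terms with s ≥ 1 project to zero), and unique determination of labels (s,k,i) is claimed except for p=q=1, where it fails: for n=2, (1,0,0) and (0,1,1) both have eigenvalues (0,0,-4). *)

theory Defs
  imports Complex_Main "HOL-Library.Poly_Mapping"
begin

text \<open>
  Complex polynomials in the variables \<open>x\<^sub>0, x\<^sub>1, \<dots>\<close>: finitely supported maps from exponents to
  coefficients. A Euclidean space is represented by the finite set of indices of its coordinates:
  with \<open>m = p + q\<close>, the polynomials on \<open>R\<^sup>m\<close>, \<open>R\<^sup>p\<close> and \<open>R\<^sup>q\<close> are those in the variables
  \<open>{1..m}\<close>, \<open>{1..p}\<close> and \<open>{p+1..m}\<close>.
\<close>

type_synonym cpoly = "(nat \<Rightarrow>\<^sub>0 nat) \<Rightarrow>\<^sub>0 complex"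

definition cscale :: "complex \<Rightarrow> cpoly \<Rightarrow> cpoly" where
  "cscale c P = Poly_Mapping.single 0 c * P"

interpretation cpoly: vector_space cscale
  by standard
    (simp_all add: cscale_def distrib_left distrib_right single_add mult_single
      mult.assoc [symmetric])

definition X :: "nat \<Rightarrow> cpoly" where
  "X j = Poly_Mapping.single (Poly_Mapping.single j 1) 1"

text \<open>The truncated exponent for \<open>lookup \<alpha> j = 0\<close> is harmless, as the coefficient is then zero.\<close>

definition pd :: "nat \<Rightarrow> cpoly \<Rightarrow> cpoly" where
  "pd j P = (\<Sum>\<alpha>\<in>Poly_Mapping.keys P.
     Poly_Mapping.single (\<alpha> - Poly_Mapping.single j 1)
       (of_nat (Poly_Mapping.lookup \<alpha> j) * Poly_Mapping.lookup P \<alpha>))"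

definition polys :: "nat set \<Rightarrow> cpoly set" where
  "polys V = {P. \<forall>\<alpha>\<in>Poly_Mapping.keys P. Poly_Mapping.keys \<alpha> \<subseteq> V}"

definition homogeneous :: "nat \<Rightarrow> cpoly \<Rightarrow> bool" where
  "homogeneous k P \<longleftrightarrow>
     (\<forall>\<alpha>\<in>Poly_Mapping.keys P. (\<Sum>j\<in>Poly_Mapping.keys \<alpha>. Poly_Mapping.lookup \<alpha> j) = k)"

definition laplacian :: "nat set \<Rightarrow> cpoly \<Rightarrow> cpoly" where
  "laplacian V P = (\<Sum>j\<in>V. pd j (pd j P))"

definition harm :: "nat set \<Rightarrow> cpoly set" where
  "harm V = {P \<in> polys V. laplacian V P = 0}"

definition harm_hom :: "nat set \<Rightarrow> nat \<Rightarrow> cpoly set" where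
  "harm_hom V k = {P \<in> harm V. homogeneous k P}"

definition norm_sq :: "nat set \<Rightarrow> cpoly" where
  "norm_sq V = (\<Sum>j\<in>V. X j ^ 2)"

text \<open>
  The value at \<open>f\<close> of the projection onto the summand \<open>s = 0\<close> of the Fischer decomposition
  \<open>polys V = (\<Oplus>s. norm_sq V ^ s * harm V)\<close>.
\<close>

definition harm_proj :: "nat set \<Rightarrow> cpoly \<Rightarrow> cpoly" where
  "harm_proj V f = (THE h. \<exists>(N::nat) H. (\<forall>s\<le>N. H s \<in> harm V) \<and>
     f = (\<Sum>s\<le>N. norm_sq V ^ s * H s) \<and> h = H 0)"

text \<open>
  \<open>pd_pow \<alpha>\<close> is the composition of the \<open>pd j\<close>, each taken \<open>lookup \<alpha> j\<close> times, and
  \<open>diff_op_cnj P\<close> is obtained from \<open>P\<close> by conjugating the coefficients and replacing every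
  variable \<open>x\<^sub>j\<close> by \<open>pd j\<close>.
\<close>

definition pd_pow :: "(nat \<Rightarrow>\<^sub>0 nat) \<Rightarrow> cpoly \<Rightarrow> cpoly" where
  "pd_pow \<alpha> = foldr (\<lambda>j F. (pd j ^^ Poly_Mapping.lookup \<alpha> j) \<circ> F)
     (sorted_list_of_set (Poly_Mapping.keys \<alpha>)) id"

definition diff_op_cnj :: "cpoly \<Rightarrow> cpoly \<Rightarrow> cpoly" where
  "diff_op_cnj P Q =
     (\<Sum>\<alpha>\<in>Poly_Mapping.keys P. cscale (cnj (Poly_Mapping.lookup P \<alpha>)) (pd_pow \<alpha> Q))"

text \<open>
  The coefficient of the exponent \<open>0\<close> is the value at the origin. The formula does not involve the
  dimension: it gives the Fischer inner product on \<open>polys V\<close> for every \<open>V\<close>.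
\<close>

definition fischer :: "cpoly \<Rightarrow> cpoly \<Rightarrow> complex" where
  "fischer P Q = Poly_Mapping.lookup (diff_op_cnj P Q) 0"

definition basis_family :: "('i \<Rightarrow> cpoly) \<Rightarrow> 'i set \<Rightarrow> cpoly set \<Rightarrow> bool" where
  "basis_family B I U \<longleftrightarrow>
     inj_on B I \<and> cpoly.independent (B ` I) \<and> cpoly.span (B ` I) = U"

definition orthogonal_family :: "('i \<Rightarrow> cpoly) \<Rightarrow> 'i set \<Rightarrow> bool" where
  "orthogonal_family B I \<longleftrightarrow> (\<forall>a\<in>I. \<forall>b\<in>I. a \<noteq> b \<longrightarrow> fischer (B a) (B b) = 0)"

definition orthogonal_basis :: "('i \<Rightarrow> cpoly) \<Rightarrow> 'i set \<Rightarrow> cpoly set \<Rightarrow> bool" where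
  "orthogonal_basis B I U \<longleftrightarrow> basis_family B I U \<and> orthogonal_family B I"

definition orthonormal_basis :: "('i \<Rightarrow> cpoly) \<Rightarrow> 'i set \<Rightarrow> cpoly set \<Rightarrow> bool" where
  "orthonormal_basis B I U \<longleftrightarrow> orthogonal_basis B I U \<and> (\<forall>a\<in>I. fischer (B a) (B a) = 1)"

definition angular :: "nat \<Rightarrow> nat \<Rightarrow> cpoly \<Rightarrow> cpoly" where
  "angular a b P = X a * pd b P - X b * pd a P"

definition laplace_beltrami :: "nat set \<Rightarrow> cpoly \<Rightarrow> cpoly" where
  "laplace_beltrami V P =
     (\<Sum>(a, b)\<in>{(a, b). a \<in> V \<and> b \<in> V \<and> a < b}. angular a b (angular a b P))"

definition LB_eigenvalue :: "nat \<Rightarrow> nat \<Rightarrow> int" where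
  "LB_eigenvalue d k = - (int k * (int k + int d - 2))"

definition eigenfunction :: "(cpoly \<Rightarrow> cpoly) \<Rightarrow> int \<Rightarrow> cpoly \<Rightarrow> bool" where
  "eigenfunction T c f \<longleftrightarrow> f \<noteq> 0 \<and> T f = cscale (of_int c) f"

definition commute_on :: "cpoly set \<Rightarrow> (cpoly \<Rightarrow> cpoly) \<Rightarrow> (cpoly \<Rightarrow> cpoly) \<Rightarrow> bool" where
  "commute_on U S T \<longleftrightarrow> (\<forall>f\<in>U. S (T f) = T (S f))"

end

theory Submission
  imports Defs
begin

text \<open>
  Multiplication by \<open>X j\<close> is adjoint to \<open>pd j\<close>, hence multiplication by \<open>norm_sq V\<close> is adjoint to
  \<open>laplacian V\<close>; so no nonzero harmonic polynomial is divisible by \<open>norm_sq V\<close>, and the Fischer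
  decomposition is unique. For \<open>T = S\<^sub>k(u) Q\<^sub>i(v)\<close> a two-term recursion gives a nonzero harmonic
  combination of the \<open>|u|\<^sup>2\<^sup>a |v|\<^sup>2\<^sup>b T\<close>, \<open>a + b = s\<close>. Modulo \<open>|x|\<^sup>2\<close> it is a multiple of
  \<open>|u|\<^sup>2\<^sup>s T\<close>, so up to a nonzero factor it is the harmonic projection of \<open>|u|\<^sup>2\<^sup>s T\<close>. Orthogonality and
  the eigenvalues in \<open>u\<close> and \<open>v\<close> can be read off from this form, as \<open>|u|\<^sup>2\<close> and \<open>|v|\<^sup>2\<close> are rotation
  invariant. For the spanning property, decompose monomials in \<open>u\<close> and in \<open>v\<close> separately and
  reduce modulo \<open>|x|\<^sup>2\<close>.
\<close>

section \<open>Partial derivatives, supports and degrees\<close>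

text \<open>The projection is never computed from its definition. Up to normalisation its
  coefficients in the terms |u|^(2a) |v|^(2b) T are those of a Jacobi polynomial, and closed
  formulas for them would need special identities. Everything passes instead through one
  characterisation: h is the projection of f as soon as h is harmonic and f - h is a multiple of
  |x|^2. Linear independence likewise needs no comparison of dimensions, since nonzero orthogonal
  elements are independent. The claim about the labels has one exception. In dimension 1 the degrees
  0 and 1 both have eigenvalue 0, so for p = q = 1 the triples (0,1,0) and (0,0,1) share all three
  eigenvalues; injectivity is therefore stated outside that case. When just one of p and q is 1, the
  parity of the total degree 2s + k + i decides.\<close>

abbreviation lookup where "lookup \<equiv> Poly_Mapping.lookup"
abbreviation keys where "keys \<equiv> Poly_Mapping.keys"
abbreviation single where "single \<equiv> Poly_Mapping.single"

lemma poly_sum_singles: "P = (\<Sum>\<alpha>\<in>keys P. single \<alpha> (lookup P \<alpha>))"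
  by (rule poly_mapping_eqI)
    (auto simp: lookup_sum lookup_single when_def in_keys_iff)

text \<open>Restricting the case \<open>single\<close> to exponents that occur in \<open>f\<close>
  carries properties of all monomials of \<open>f\<close>, such as membership in
  \<open>polys V\<close>, into the induction.\<close>

lemma poly_induct [case_names single add zero]:
  fixes f :: "'a \<Rightarrow>\<^sub>0 'b::comm_monoid_add"
  assumes single: "\<And>\<alpha> c. \<alpha> \<in> keys f \<Longrightarrow> P (single \<alpha> c)"
    and add: "\<And>f g. P f \<Longrightarrow> P g \<Longrightarrow> P (f + g)"
    and zero: "P 0"
  shows "P f"
proof -
  have "P (\<Sum>\<alpha>\<in>A. single \<alpha> (lookup f \<alpha>))" if "A \<subseteq> keys f" for A
    using finite_subset[OF that finite_keys] that
    by (induction A rule: finite_induct) (auto intro: assms)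
  from this[of "keys f"] show ?thesis
    by (metis order_refl poly_mapping_eqI poly_sum_singles)
qed

lemma diff_single_add_cancel:
  "lookup \<alpha> j \<noteq> 0 \<Longrightarrow> \<alpha> - single j 1 + single j (1::nat) = \<alpha>"
  by (rule poly_mapping_eqI) (auto simp: lookup_add lookup_minus lookup_single when_def)

lemma exponent_induct [consumes 1, case_names zero add]:
  assumes "keys \<alpha> \<subseteq> V" and zero: "P 0"
    and add: "\<And>\<alpha> j. j \<in> V \<Longrightarrow> keys \<alpha> \<subseteq> V \<Longrightarrow> P \<alpha> \<Longrightarrow> P (\<alpha> + single j (1::nat))"
  shows "P \<alpha>"
  using assms(1)
proof (induction "\<Sum>j\<in>keys \<alpha>. lookup \<alpha> j" arbitrary: \<alpha> rule: less_induct)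
  case less
  show ?case
  proof (cases "\<alpha> = 0")
    case False
    then obtain j where j: "j \<in> keys \<alpha>" by (metis keys_eq_empty equals0I)
    define \<beta> where "\<beta> = \<alpha> - single j 1"
    have \<alpha>: "\<alpha> = \<beta> + single j 1"
      unfolding \<beta>_def by (rule diff_single_add_cancel[symmetric]) (use j in \<open>simp add: in_keys_iff\<close>)
    have keys: "keys \<beta> \<subseteq> keys \<alpha>"
      by (auto simp: \<beta>_def in_keys_iff lookup_minus)
    have "(\<Sum>i\<in>keys \<beta>. lookup \<beta> i) = (\<Sum>i\<in>keys \<alpha>. lookup \<beta> i)"
      by (intro sum.mono_neutral_left) (use keys in \<open>auto simp: in_keys_iff\<close>)
    also have "\<dots> < (\<Sum>i\<in>keys \<alpha>. lookup \<alpha> i)"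
      by (intro sum_strict_mono_ex1)
        (use j in \<open>auto simp: \<beta>_def lookup_minus lookup_single in_keys_iff intro!: bexI[of _ j]\<close>)
    finally have "P \<beta>" using less keys by auto
    then show ?thesis using \<alpha> j less.prems keys add[of j \<beta>] by auto
  qed (use zero in simp)
qed

lemma lookup_pd: "lookup (pd j P) \<alpha> = of_nat (lookup \<alpha> j + 1) * lookup P (\<alpha> + single j 1)"
proof -
  have "lookup (pd j P) \<alpha> = (\<Sum>\<beta>\<in>keys P. of_nat (lookup \<beta> j) * lookup P \<beta> when \<beta> - single j 1 = \<alpha>)"
    by (simp add: pd_def lookup_sum lookup_single)
  also have "\<dots> = (\<Sum>\<beta>\<in>keys P. if \<beta> = \<alpha> + single j 1 then of_nat (lookup \<beta> j) * lookup P \<beta> else 0)"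
  proof (intro sum.cong refl)
    fix \<beta>
    have "\<beta> - single j 1 = \<alpha> \<longleftrightarrow> \<beta> = \<alpha> + single j 1" if "lookup \<beta> j \<noteq> 0"
      using diff_single_add_cancel[OF that] by auto
    then show "(of_nat (lookup \<beta> j) * lookup P \<beta> when \<beta> - single j 1 = \<alpha>)
      = (if \<beta> = \<alpha> + single j 1 then of_nat (lookup \<beta> j) * lookup P \<beta> else 0)"
      by (cases "lookup \<beta> j = 0") (auto simp: when_def)
  qed
  also have "\<dots> = of_nat (lookup \<alpha> j + 1) * lookup P (\<alpha> + single j 1)"
    by (auto simp: in_keys_iff lookup_add)
  finally show ?thesis .
qed

lemma pd_zero [simp]: "pd j 0 = 0"
  by (simp add: pd_def)

lemma pd_add: "pd j (P + Q) = pd j P + pd j Q"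
  by (rule poly_mapping_eqI) (simp add: lookup_pd lookup_add algebra_simps)

lemma pd_diff: "pd j (P - Q) = pd j P - pd j Q"
  by (rule poly_mapping_eqI) (simp add: lookup_pd lookup_minus algebra_simps)

lemma pd_sum: "pd j (\<Sum>i\<in>A. f i) = (\<Sum>i\<in>A. pd j (f i))"
  by (induction A rule: infinite_finite_induct) (simp_all add: pd_add)

lemma pd_single: "pd j (single \<alpha> c) = single (\<alpha> - single j 1) (of_nat (lookup \<alpha> j) * c)"
  by (cases "c = 0") (simp_all add: pd_def)

lemma pd_const [simp]: "pd j (single 0 c) = 0"
  by (simp add: pd_single)

lemma pd_commute: "pd i (pd j P) = pd j (pd i P)"
  by (rule poly_mapping_eqI) (auto simp: lookup_pd lookup_add lookup_single when_def algebra_simps)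

lemma pd_mult_single:
  "pd j (single \<alpha> c * single \<beta> d) = pd j (single \<alpha> c) * single \<beta> d + single \<alpha> c * pd j (single \<beta> d)"
proof -
  have "\<alpha> - single j 1 + \<beta> = \<alpha> + \<beta> - single j 1" if "lookup \<alpha> j \<noteq> 0" for \<alpha> \<beta> :: "nat \<Rightarrow>\<^sub>0 nat"
    by (rule poly_mapping_eqI)
      (use that in \<open>auto simp: lookup_add lookup_minus lookup_single when_def\<close>)
  from this[of \<alpha> \<beta>] this[of \<beta> \<alpha>] show ?thesis
    by (cases "lookup \<alpha> j = 0"; cases "lookup \<beta> j = 0")
      (auto simp: pd_single mult_single lookup_add add.commute algebra_simps single_add [symmetric])
qed

lemma pd_mult: "pd j (P * Q) = pd j P * Q + P * pd j Q"
proof (induction P rule: poly_induct)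
  case (single \<alpha> c)
  show ?case
    by (induction Q rule: poly_induct)
      (simp_all add: pd_mult_single pd_add algebra_simps)
qed (simp_all add: pd_add algebra_simps)

lemma pd_one [simp]: "pd j 1 = 0"
  using pd_const[of j 1] by simp

lemma pd_of_nat [simp]: "pd j (of_nat n) = 0"
  using pd_const[of j "of_nat n"] by simp

lemma pd_numeral [simp]: "pd j (numeral n) = 0"
  using pd_const[of j "numeral n"] by simp

lemma pd_X: "pd i (X j) = (if i = j then 1 else 0)"
  by (simp add: X_def pd_single lookup_single when_def)

lemma X_mult_single: "X j * single \<alpha> c = single (\<alpha> + single j 1) c"
  by (simp add: X_def mult_single add.commute)

section \<open>Polynomials in a given set of variables\<close>

lemma polysI: "(\<And>\<alpha>. lookup P \<alpha> \<noteq> 0 \<Longrightarrow> keys \<alpha> \<subseteq> V) \<Longrightarrow> P \<in> polys V"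
  by (auto simp: polys_def in_keys_iff)

lemma polys_zero [simp]: "0 \<in> polys V" by (simp add: polys_def)

lemma polys_const [simp]: "single 0 c \<in> polys V" by (auto simp: polys_def)

lemma polys_one [simp]: "1 \<in> polys V" by (auto simp: polys_def)

lemma polys_X [simp]: "j \<in> V \<Longrightarrow> X j \<in> polys V" by (auto simp: polys_def X_def)

lemma polys_add: "P \<in> polys V \<Longrightarrow> Q \<in> polys V \<Longrightarrow> P + Q \<in> polys V"
  using keys_add[of P Q] by (auto simp: polys_def)

lemma polys_uminus: "P \<in> polys V \<Longrightarrow> - P \<in> polys V"
  by (simp add: polys_def in_keys_iff)

lemma polys_diff: "P \<in> polys V \<Longrightarrow> Q \<in> polys V \<Longrightarrow> P - Q \<in> polys V"
  using polys_add[of P V "- Q"] polys_uminus by simp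

lemma polys_mult: "P \<in> polys V \<Longrightarrow> Q \<in> polys V \<Longrightarrow> P * Q \<in> polys V"
proof -
  assume PQ: "P \<in> polys V" "Q \<in> polys V"
  have "keys (\<alpha> + \<beta>) \<subseteq> V" if "\<alpha> \<in> keys P" "\<beta> \<in> keys Q" for \<alpha> \<beta>
    using that PQ keys_add[of \<alpha> \<beta>] unfolding polys_def by blast
  then show ?thesis
    using keys_mult[of P Q] unfolding polys_def by blast
qed

lemma polys_sum: "(\<And>i. i \<in> A \<Longrightarrow> f i \<in> polys V) \<Longrightarrow> (\<Sum>i\<in>A. f i) \<in> polys V"
  by (induction A rule: infinite_finite_induct) (auto intro: polys_add)

lemma polys_power: "P \<in> polys V \<Longrightarrow> P ^ n \<in> polys V"
  by (induction n) (auto intro: polys_mult)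

lemma polys_mono: "U \<subseteq> V \<Longrightarrow> polys U \<subseteq> polys V"
  by (auto simp: polys_def)

lemma polys_pd: "P \<in> polys V \<Longrightarrow> pd j P \<in> polys V"
proof (rule polysI)
  fix \<alpha> assume P: "P \<in> polys V" and "lookup (pd j P) \<alpha> \<noteq> 0"
  then have "\<alpha> + single j 1 \<in> keys P" by (simp add: lookup_pd in_keys_iff)
  then have "keys (\<alpha> + single j 1) \<subseteq> V" using P by (simp add: polys_def)
  then show "keys \<alpha> \<subseteq> V" by (auto simp: in_keys_iff lookup_add)
qed

lemma pd_eq_0: "P \<in> polys V \<Longrightarrow> j \<notin> V \<Longrightarrow> pd j P = 0"
proof (rule poly_mapping_eqI)
  fix \<alpha> assume "P \<in> polys V" "j \<notin> V"
  then have "\<alpha> + single j 1 \<notin> keys P"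
    by (auto simp: polys_def in_keys_iff lookup_add dest!: bspec subsetD[of _ _ j])
  then show "lookup (pd j P) \<alpha> = lookup 0 \<alpha>" by (simp add: lookup_pd in_keys_iff)
qed

text \<open>This induction is shaped for adjointness arguments: each factor \<open>X j\<close> can
  be moved across the Fischer product as a derivative.\<close>

lemma polys_induct [consumes 1, case_names const X_mult add]:
  assumes "f \<in> polys V"
    and const: "\<And>c. P (single 0 c)"
    and X_mult: "\<And>j f. j \<in> V \<Longrightarrow> f \<in> polys V \<Longrightarrow> P f \<Longrightarrow> P (X j * f)"
    and add: "\<And>f g. P f \<Longrightarrow> P g \<Longrightarrow> P (f + g)"
  shows "P f"
proof (induction f rule: poly_induct)
  case (single \<alpha> c)
  then have "keys \<alpha> \<subseteq> V" using assms(1) by (auto simp: polys_def)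
  then show ?case
  proof (induction \<alpha> rule: exponent_induct)
    case (add \<alpha> j)
    then show ?case 
      using X_mult[of j "single \<alpha> c"] by (auto simp: X_mult_single polys_def)
  qed (rule const)
qed (use const[of 0] add in auto)

section \<open>Degree, homogeneity and the Euler operator\<close>

definition expdeg :: "(nat \<Rightarrow>\<^sub>0 nat) \<Rightarrow> nat" where
  "expdeg \<alpha> = (\<Sum>j\<in>keys \<alpha>. lookup \<alpha> j)"

lemma expdeg_zero [simp]: "expdeg 0 = 0"
  by (simp add: expdeg_def)

lemma expdeg_single [simp]: "expdeg (single j n) = n"
  by (simp add: expdeg_def)

lemma expdeg_sum: "finite A \<Longrightarrow> keys \<alpha> \<subseteq> A \<Longrightarrow> expdeg \<alpha> = (\<Sum>j\<in>A. lookup \<alpha> j)"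
  unfolding expdeg_def by (rule sum.mono_neutral_left) (auto simp: in_keys_iff)

lemma expdeg_add: "expdeg (\<alpha> + \<beta>) = expdeg \<alpha> + expdeg \<beta>"
  using keys_add[of \<alpha> \<beta>]
  by (simp add: expdeg_sum[of "keys \<alpha> \<union> keys \<beta>"] lookup_add sum.distrib)

lemma homogeneous_iff: "homogeneous k P \<longleftrightarrow> (\<forall>\<alpha>. lookup P \<alpha> \<noteq> 0 \<longrightarrow> expdeg \<alpha> = k)"
  by (auto simp: homogeneous_def expdeg_def in_keys_iff)

lemma homogeneous_zero [simp]: "homogeneous k 0"
  by (simp add: homogeneous_iff)

lemma homogeneous_const [simp]: "homogeneous 0 (single 0 c)"
  by (auto simp: homogeneous_iff lookup_single when_def)

lemma homogeneous_one [simp]: "homogeneous 0 1"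
  using homogeneous_const[of 1] by simp

lemma homogeneous_X [simp]: "homogeneous 1 (X j)"
  by (auto simp: homogeneous_iff X_def lookup_single when_def)

lemma homogeneous_add: "homogeneous k P \<Longrightarrow> homogeneous k Q \<Longrightarrow> homogeneous k (P + Q)"
  unfolding homogeneous_iff lookup_add
proof (intro allI impI)
  fix \<alpha>
  assume *: "\<forall>\<alpha>. lookup P \<alpha> \<noteq> 0 \<longrightarrow> expdeg \<alpha> = k" "\<forall>\<alpha>. lookup Q \<alpha> \<noteq> 0 \<longrightarrow> expdeg \<alpha> = k"
    and "lookup P \<alpha> + lookup Q \<alpha> \<noteq> 0"
  then have "lookup P \<alpha> \<noteq> 0 \<or> lookup Q \<alpha> \<noteq> 0" by auto
  with * show "expdeg \<alpha> = k" by blast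
qed

lemma homogeneous_uminus: "homogeneous k P \<Longrightarrow> homogeneous k (- P)"
  by (auto simp: homogeneous_iff)

lemma homogeneous_diff: "homogeneous k P \<Longrightarrow> homogeneous k Q \<Longrightarrow> homogeneous k (P - Q)"
  using homogeneous_add[of k P "- Q"] homogeneous_uminus by simp

lemma homogeneous_sum: "(\<And>i. i \<in> A \<Longrightarrow> homogeneous k (f i)) \<Longrightarrow> homogeneous k (\<Sum>i\<in>A. f i)"
  by (induction A rule: infinite_finite_induct) (auto intro: homogeneous_add)

lemma homogeneous_mult: "homogeneous k P \<Longrightarrow> homogeneous l Q \<Longrightarrow> homogeneous (k + l) (P * Q)"
  using keys_mult[of P Q] by (auto simp: homogeneous_iff in_keys_iff[symmetric] expdeg_add)

lemma homogeneous_const_mult: "homogeneous k P \<Longrightarrow> homogeneous k (single 0 c * P)"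
  using homogeneous_mult[OF homogeneous_const] by fastforce

lemma homogeneous_power: "homogeneous k P \<Longrightarrow> homogeneous (n * k) (P ^ n)"
  by (induction n) (auto dest: homogeneous_mult)

text \<open>The Euler operator in the variables \<open>V\<close> only. It therefore also measures
  the degree in u of a product S(u) Q(v).\<close>

definition euler :: "nat set \<Rightarrow> cpoly \<Rightarrow> cpoly" where
  "euler V P = (\<Sum>j\<in>V. X j * pd j P)"

lemma lookup_X_mult:
  "lookup (X j * P) \<alpha> = (if lookup \<alpha> j = 0 then 0 else lookup P (\<alpha> - single j 1))"
proof (induction P rule: poly_induct)
  case (single \<beta> c)
  have "\<beta> + single j 1 = \<alpha> \<longleftrightarrow> lookup \<alpha> j \<noteq> 0 \<and> \<beta> = \<alpha> - single j 1"
    by (auto simp: diff_single_add_cancel[simplified] lookup_add)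
  then show ?case by (auto simp: X_mult_single lookup_single when_def)
qed (auto simp: lookup_add algebra_simps)

lemma lookup_X_mult_pd: "lookup (X j * pd j P) \<alpha> = of_nat (lookup \<alpha> j) * lookup P \<alpha>"
proof (cases "lookup \<alpha> j = 0")
  case False
  then have "\<alpha> - single j 1 + single j 1 = \<alpha>"
    by (rule diff_single_add_cancel)
  with False show ?thesis by (simp add: lookup_X_mult lookup_pd lookup_minus)
qed (simp add: lookup_X_mult)

lemma euler_homogeneous:
  assumes "finite V" "P \<in> polys V" "homogeneous k P"
  shows "euler V P = of_nat k * P"
proof (rule poly_mapping_eqI)
  fix \<alpha>
  have "lookup (euler V P) \<alpha> = (\<Sum>j\<in>V. of_nat (lookup \<alpha> j)) * lookup P \<alpha>"
    by (simp add: euler_def lookup_sum lookup_X_mult_pd sum_distrib_right)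
  also have "\<dots> = of_nat k * lookup P \<alpha>"
  proof (cases "lookup P \<alpha> = 0")
    case False
    then have "keys \<alpha> \<subseteq> V" "expdeg \<alpha> = k"
      using assms by (auto simp: polys_def in_keys_iff homogeneous_iff)
    then show ?thesis using expdeg_sum[OF assms(1)] by (metis of_nat_sum)
  qed simp
  also have "\<dots> = lookup (of_nat k * P) \<alpha>"
  proof -
    have "lookup (of_nat k * P) \<alpha> = of_nat k * lookup P \<alpha>" for k
      by (induction k) (simp_all add: algebra_simps lookup_add)
    then show ?thesis by simp
  qed
  finally show "lookup (euler V P) \<alpha> = lookup (of_nat k * P) \<alpha>" .
qed

text \<open>An exponent \<alpha> that survives satisfies \<open>expdeg \<alpha> + 2 = n\<close>.
  Truncated subtraction hides that none survives for n < 2, hence the second fact.\<close>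

lemma homogeneous_laplacian: "homogeneous n P \<Longrightarrow> homogeneous (n - 2) (laplacian V P)"
  and laplacian_eq_0: "homogeneous n P \<Longrightarrow> n < 2 \<Longrightarrow> laplacian V P = 0"
proof -
  assume P: "homogeneous n P"
  have *: "expdeg \<alpha> + 2 = n" if "lookup (laplacian V P) \<alpha> \<noteq> 0" for \<alpha>
  proof -
    have "(\<Sum>j\<in>V. lookup (pd j (pd j P)) \<alpha>) \<noteq> 0"
      using that by (simp add: laplacian_def lookup_sum)
    then obtain j where "lookup (pd j (pd j P)) \<alpha> \<noteq> 0"
      using sum.not_neutral_contains_not_neutral by blast
    then have "lookup P (\<alpha> + single j 1 + single j 1) \<noteq> 0"
      by (auto simp: lookup_pd)
    then have "expdeg (\<alpha> + single j 1 + single j 1) = n"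
      using P by (simp add: homogeneous_iff)
    then show ?thesis by (simp add: expdeg_add)
  qed
  show "homogeneous (n - 2) (laplacian V P)"
    unfolding homogeneous_iff using * by fastforce
  show "laplacian V P = 0" if "n < 2"
    using * that by (intro poly_mapping_eqI) force
qed

section \<open>The Fischer inner product\<close>

lemma lookup_const_mult: "lookup (single 0 c * P) \<alpha> = c * lookup P \<alpha>"
  by (induction P rule: poly_induct)
    (auto simp: mult_single lookup_single when_def lookup_add algebra_simps)

lemma lookup_mult_0: "lookup (P * Q) 0 = lookup P 0 * lookup (Q :: cpoly) 0"
proof (induction P rule: poly_induct)
  case (single \<alpha> c)
  have *: "\<alpha> + \<beta> = 0 \<longleftrightarrow> \<alpha> = 0 \<and> \<beta> = 0" for \<alpha> \<beta> :: "nat \<Rightarrow>\<^sub>0 nat"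
    by (auto simp: poly_mapping_eq_iff fun_eq_iff lookup_add)
  show ?case
    by (induction Q rule: poly_induct)
      (auto simp: mult_single lookup_single when_def lookup_add * algebra_simps)
qed (auto simp: lookup_add algebra_simps)

text \<open>The multi-index factorial, which is the Fischer square of the monomial with exponent
  \<alpha>.\<close>

definition expfact :: "(nat \<Rightarrow>\<^sub>0 nat) \<Rightarrow> complex" where
  "expfact \<alpha> = (\<Prod>j\<in>keys \<alpha>. fact (lookup \<alpha> j))"

lemma expfact_superset:
  "finite A \<Longrightarrow> keys \<alpha> \<subseteq> A \<Longrightarrow> expfact \<alpha> = (\<Prod>j\<in>A. fact (lookup \<alpha> j))"
  unfolding expfact_def by (rule prod.mono_neutral_left) (auto simp: in_keys_iff)

lemma expfact_zero [simp]: "expfact 0 = 1"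
  by (simp add: expfact_def)

lemma expfact_add_single:
  "expfact (\<alpha> + single j 1) = of_nat (lookup \<alpha> j + 1) * expfact \<alpha>"
proof -
  let ?A = "insert j (keys \<alpha>)"
  have "expfact (\<alpha> + single j 1) = (\<Prod>i\<in>?A. fact (lookup (\<alpha> + single j 1) i))"
    by (rule expfact_superset) (use keys_add[of \<alpha> "single j 1"] in auto)
  also have "\<dots> = fact (lookup \<alpha> j + 1) * (\<Prod>i\<in>keys \<alpha> - {j}. fact (lookup (\<alpha> + single j 1) i))"
    by (subst prod.insert_remove) (auto simp: lookup_add)
  also have "(\<Prod>i\<in>keys \<alpha> - {j}. fact (lookup (\<alpha> + single j 1) i))
      = (\<Prod>i\<in>keys \<alpha> - {j}. fact (lookup \<alpha> i) :: complex)"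
    by (intro prod.cong) (auto simp: lookup_add lookup_single)
  also have "fact (lookup \<alpha> j + 1) * \<dots> = of_nat (lookup \<alpha> j + 1) * (\<Prod>i\<in>?A. fact (lookup \<alpha> i))"
    by (subst prod.insert_remove) (auto simp: algebra_simps)
  also have "(\<Prod>i\<in>?A. fact (lookup \<alpha> i)) = expfact \<alpha>"
    by (rule expfact_superset[symmetric]) auto
  finally show ?thesis .
qed

lemma lookup_funpow_pd:
  "lookup ((pd j ^^ n) Q) \<beta> = pochhammer (of_nat (lookup \<beta> j + 1)) n * lookup Q (\<beta> + single j n)"
proof (induction n arbitrary: \<beta>)
  case (Suc n)
  have "single j (Suc n) = single j 1 + single j n"
    by (simp flip: single_add)
  with Suc show ?case
    by (simp add: lookup_pd lookup_add pochhammer_rec add_ac)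
qed simp

text \<open>As \<beta> vanishes on \<open>js\<close>, every Pochhammer factor starts at 1 and is a
  factorial. Distinctness preserves this along the list: raising position \<open>j\<close> leaves
  the remaining positions at zero.\<close>

lemma lookup_foldr_pd:
  assumes "distinct js" "\<forall>j\<in>set js. lookup \<beta> j = 0"
  shows "lookup (foldr (\<lambda>j F. (pd j ^^ lookup \<alpha> j) \<circ> F) js id Q) \<beta>
    = (\<Prod>j\<in>set js. fact (lookup \<alpha> j)) * lookup Q (\<beta> + (\<Sum>j\<in>set js. single j (lookup \<alpha> j)))"
  using assms
proof (induction js arbitrary: \<beta>)
  case (Cons j js)
  let ?F = "foldr (\<lambda>j F. (pd j ^^ lookup \<alpha> j) \<circ> F) js id Q"
  have "lookup (foldr (\<lambda>j F. (pd j ^^ lookup \<alpha> j) \<circ> F) (j # js) id Q) \<beta>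
    = fact (lookup \<alpha> j) * lookup ?F (\<beta> + single j (lookup \<alpha> j))"
    using Cons.prems by (simp add: lookup_funpow_pd pochhammer_fact)
  also have "lookup ?F (\<beta> + single j (lookup \<alpha> j)) = (\<Prod>j\<in>set js. fact (lookup \<alpha> j)) *
      lookup Q (\<beta> + single j (lookup \<alpha> j) + (\<Sum>j\<in>set js. single j (lookup \<alpha> j)))"
    using Cons.prems by (intro Cons.IH) (auto simp: lookup_add lookup_single when_def)
  finally show ?case using Cons.prems by (simp add: add.assoc)
qed simp

lemma lookup_pd_pow: "lookup (pd_pow \<alpha> Q) 0 = expfact \<alpha> * lookup Q \<alpha>"
  unfolding pd_pow_def
  by (subst lookup_foldr_pd) (simp_all add: expfact_def flip: poly_sum_singles)

text \<open>Monomials are orthogonal with square \<alpha>!; linearity, conjugate symmetry and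
  definiteness are read off from this form.\<close>

lemma fischer_eq: "fischer P Q = (\<Sum>\<alpha>\<in>keys P. cnj (lookup P \<alpha>) * (expfact \<alpha> * lookup Q \<alpha>))"
  by (simp add: fischer_def diff_op_cnj_def lookup_sum cscale_def lookup_const_mult lookup_pd_pow)

lemma fischer_superset:
  "finite A \<Longrightarrow> keys P \<subseteq> A \<Longrightarrow>
    fischer P Q = (\<Sum>\<alpha>\<in>A. cnj (lookup P \<alpha>) * (expfact \<alpha> * lookup Q \<alpha>))"
  unfolding fischer_eq by (rule sum.mono_neutral_left) (auto simp: in_keys_iff)

lemma fischer_zero_left [simp]: "fischer 0 Q = 0"
  and fischer_zero_right [simp]: "fischer P 0 = 0"
  by (simp_all add: fischer_eq)

lemma fischer_add_left: "fischer (P + P') Q = fischer P Q + fischer P' Q"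
  unfolding fischer_eq by (rule setsum_keys_plus_distrib) (auto simp: algebra_simps)

lemma fischer_add_right: "fischer P (Q + Q') = fischer P Q + fischer P Q'"
  by (simp add: fischer_eq lookup_add algebra_simps sum.distrib)

lemma fischer_single: "fischer (single \<alpha> c) Q = cnj c * (expfact \<alpha> * lookup Q \<alpha>)"
  by (simp add: fischer_eq)

lemma fischer_const: "fischer (single 0 c) Q = cnj c * lookup Q 0"
  by (simp add: fischer_single)

lemma fischer_const_mult_left: "fischer (single 0 c * P) Q = cnj c * fischer P Q"
  by (induction P rule: poly_induct)
    (auto simp: mult_single fischer_single fischer_add_left algebra_simps)

lemma fischer_const_mult_right: "fischer P (single 0 c * Q) = c * fischer P Q"
  by (simp add: fischer_eq lookup_const_mult sum_distrib_left mult.left_commute)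

lemma fischer_sum_left: "fischer (\<Sum>i\<in>A. f i) Q = (\<Sum>i\<in>A. fischer (f i) Q)"
  by (induction A rule: infinite_finite_induct) (simp_all add: fischer_add_left)

lemma fischer_sum_right: "fischer P (\<Sum>i\<in>A. f i) = (\<Sum>i\<in>A. fischer P (f i))"
  by (induction A rule: infinite_finite_induct) (simp_all add: fischer_add_right)

lemma fischer_commute: "fischer Q P = cnj (fischer P Q)"
proof -
  have "cnj (expfact \<alpha>) = expfact \<alpha>" for \<alpha> by (simp add: expfact_def)
  then show ?thesis
    by (simp add: fischer_superset[of "keys P \<union> keys Q"] algebra_simps)
qed

lemma fischer_self_nonzero:
  assumes "P \<noteq> 0"
  shows "fischer P P \<noteq> 0"
proof -
  let ?f = "\<lambda>\<alpha>. (norm (lookup P \<alpha>))\<^sup>2 * (\<Prod>j\<in>keys \<alpha>. fact (lookup \<alpha> j))"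
  have eq: "fischer P P = of_real (\<Sum>\<alpha>\<in>keys P. ?f \<alpha>)"
    unfolding fischer_eq of_real_sum
    by (intro sum.cong refl)
      (simp add: expfact_def complex_norm_square algebra_simps del: of_real_power)
  have pos: "(\<Sum>\<alpha>\<in>keys P. ?f \<alpha>) > 0"
    using assms by (intro sum_pos) (auto simp: in_keys_iff intro!: mult_pos_pos prod_pos)
  show ?thesis unfolding eq of_real_eq_0_iff using pos by linarith
qed

text \<open>The factor by which the factorial grows when \<alpha> is raised at \<open>j\<close> is
  the one that \<open>pd j\<close> produces.\<close>

lemma fischer_X_mult: "fischer (X j * P) Q = fischer P (pd j Q)"
  by (induction P rule: poly_induct)
    (simp_all add: X_mult_single fischer_single expfact_add_single[simplified] lookup_pd
      fischer_add_left algebra_simps)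

lemma fischer_norm_sq_mult: "fischer (norm_sq V * P) Q = fischer P (laplacian V Q)"
  by (simp add: norm_sq_def laplacian_def sum_distrib_right fischer_sum_left fischer_sum_right
      fischer_X_mult power2_eq_square mult.assoc)

lemma fischer_homogeneous:
  "homogeneous k P \<Longrightarrow> homogeneous l Q \<Longrightarrow> k \<noteq> l \<Longrightarrow> fischer P Q = 0"
  unfolding fischer_eq homogeneous_iff by (intro sum.neutral) (auto simp: in_keys_iff)

text \<open>Variables of \<open>P\<close> cross over as derivatives, which annihilate
  \<open>Q'\<close> and so act on \<open>P'\<close> alone; in the same way those of \<open>Q\<close>
  act on \<open>Q'\<close> alone.\<close>

lemma fischer_mult_disjoint:
  assumes "U \<inter> V = {}" "P \<in> polys U" "P' \<in> polys U" "Q \<in> polys V" "Q' \<in> polys V"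
  shows "fischer (P * Q) (P' * Q') = fischer P P' * fischer Q Q'"
proof -
  \<comment> \<open>The case of constant \<open>P\<close>: the derivatives coming from
    \<open>Q\<close> pass \<open>P'\<close> by, and evaluation at the origin leaves its constant
    term.\<close>
  have const: "fischer Q (P' * Q') = lookup P' 0 * fischer Q Q'" if "P' \<in> polys U" for P'
    using assms(4,5)
  proof (induction Q arbitrary: Q' rule: polys_induct)
    case (X_mult j Q)
    have "pd j P' = 0" using pd_eq_0[OF that] X_mult(1) assms(1) by auto
    then show ?case
      using X_mult by (simp add: fischer_X_mult pd_mult polys_pd)
  qed (simp_all add: fischer_const lookup_mult_0 fischer_add_left algebra_simps)
  show ?thesis
    using assms(2,3)
  proof (induction P arbitrary: P' rule: polys_induct)
    case (X_mult j P)
    have "pd j Q' = 0" using pd_eq_0[OF assms(5)] X_mult(1) assms(1) by auto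
    then show ?case
      using X_mult by (simp add: fischer_X_mult pd_mult polys_pd mult.assoc)
  qed (simp_all add: fischer_const fischer_const_mult_left const fischer_add_left distrib_right)
qed

section \<open>The Fischer decomposition\<close>

lemma laplacian_zero [simp]: "laplacian V 0 = 0"
  by (simp add: laplacian_def)

lemma laplacian_add: "laplacian V (P + Q) = laplacian V P + laplacian V Q"
  by (simp add: laplacian_def pd_add sum.distrib)

lemma laplacian_diff: "laplacian V (P - Q) = laplacian V P - laplacian V Q"
  by (simp add: laplacian_def pd_diff sum_subtractf)

lemma laplacian_sum: "laplacian V (\<Sum>i\<in>A. f i) = (\<Sum>i\<in>A. laplacian V (f i))"
  by (induction A rule: infinite_finite_induct) (simp_all add: laplacian_add)

lemma laplacian_mult_left:
  "(\<And>j. j \<in> V \<Longrightarrow> pd j G = 0) \<Longrightarrow> laplacian V (G * F) = G * laplacian V F"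
  by (simp add: laplacian_def pd_mult sum_distrib_left)

lemma laplacian_const_mult: "laplacian V (single 0 c * F) = single 0 c * laplacian V F"
  by (simp add: laplacian_mult_left)

lemma euler_mult_left:
  "(\<And>j. j \<in> V \<Longrightarrow> pd j G = 0) \<Longrightarrow> euler V (G * F) = G * euler V F"
  by (simp add: euler_def pd_mult sum_distrib_left mult.left_commute)

lemma euler_mult: "euler V (F * G) = euler V F * G + F * euler V G"
  by (simp add: euler_def pd_mult sum_distrib_left sum_distrib_right sum.distrib algebra_simps)

section \<open>The squared norm, the Laplacian and the Euler operator\<close>

lemma pd_norm_sq:
  assumes "finite V" shows "pd i (norm_sq V) = (if i \<in> V then 2 * X i else 0)"
proof -
  have "pd i (norm_sq V) = (\<Sum>j\<in>V. if i = j then 2 * X j else 0)"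
    unfolding norm_sq_def pd_sum
    by (intro sum.cong refl) (simp add: power2_eq_square pd_mult pd_X)
  then show ?thesis using assms by simp
qed

lemma polys_norm_sq [simp]: "U \<subseteq> V \<Longrightarrow> norm_sq U \<in> polys V"
  unfolding norm_sq_def by (intro polys_sum polys_power polys_X) auto

lemma homogeneous_norm_sq [simp]: "homogeneous 2 (norm_sq V)"
  unfolding norm_sq_def using homogeneous_power[OF homogeneous_X, of 2]
  by (intro homogeneous_sum) simp

lemma euler_norm_sq: "finite V \<Longrightarrow> euler V (norm_sq V) = 2 * norm_sq V"
  by (simp add: euler_def pd_norm_sq) (simp add: norm_sq_def sum_distrib_left power2_eq_square algebra_simps)

text \<open>The sl(2) relation: the commutator of the Laplacian with |x|^2 is 4E + 2d, where E is
  the Euler operator and d the dimension.\<close>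

lemma laplacian_norm_sq_mult:
  assumes "finite V"
  shows "laplacian V (norm_sq V * F)
    = of_nat (2 * card V) * F + 4 * euler V F + norm_sq V * laplacian V F"
proof -
  have "pd i (pd i (norm_sq V * F)) = 2 * F + 4 * (X i * pd i F) + norm_sq V * pd i (pd i F)"
    if "i \<in> V" for i
    using that assms by (simp add: pd_mult pd_add pd_norm_sq pd_X algebra_simps)
  then have "laplacian V (norm_sq V * F)
    = (\<Sum>i\<in>V. 2 * F + 4 * (X i * pd i F) + norm_sq V * pd i (pd i F))"
    by (simp add: laplacian_def)
  then show ?thesis
    by (simp add: sum.distrib sum_distrib_left laplacian_def euler_def algebra_simps)
qed

text \<open>Unlike in \<open>harm_hom\<close>, \<open>T\<close> may contain further variables, which
  act as parameters. Thus S(u) Q(v) is solid both for the variables of u and for those of v.\<close>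

definition solid :: "nat set \<Rightarrow> nat \<Rightarrow> cpoly \<Rightarrow> bool" where
  "solid V k T \<longleftrightarrow> laplacian V T = 0 \<and> euler V T = of_nat k * T"

lemma solid_harm_hom: "finite V \<Longrightarrow> T \<in> harm_hom V k \<Longrightarrow> solid V k T"
  by (simp add: solid_def harm_hom_def harm_def euler_homogeneous)

lemma solid_mult_left:
  "(\<And>j. j \<in> V \<Longrightarrow> pd j G = 0) \<Longrightarrow> solid V k T \<Longrightarrow> solid V k (G * T)"
  by (simp add: solid_def laplacian_mult_left euler_mult_left mult.left_commute)

lemma euler_norm_sq_power:
  assumes "finite V" "solid V k T"
  shows "euler V (norm_sq V ^ a * T) = of_nat (2 * a + k) * (norm_sq V ^ a * T)"
proof (induction a)
  case (Suc a)
  have "euler V (norm_sq V ^ Suc a * T) = euler V (norm_sq V * (norm_sq V ^ a * T))"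
    by (simp add: mult.assoc)
  also have "\<dots> = 2 * norm_sq V * (norm_sq V ^ a * T)
      + norm_sq V * (of_nat (2 * a + k) * (norm_sq V ^ a * T))"
    by (simp only: euler_mult[of V "norm_sq V"] euler_norm_sq[OF assms(1)] Suc)
  finally show ?case by (simp add: algebra_simps)
qed (use assms in \<open>simp add: solid_def\<close>)

text \<open>The constant is the sum of the commutators 2d + 4(2j + k) over j = 0, ..., a, with d =
  \<open>card V\<close>.\<close>

lemma laplacian_norm_sq_power:
  assumes "finite V" "solid V k T"
  shows "laplacian V (norm_sq V ^ Suc a * T)
    = of_nat (2 * Suc a * (2 * a + card V + 2 * k)) * (norm_sq V ^ a * T)"
proof (induction a)
  case 0
  have "laplacian V (norm_sq V * T) = of_nat (2 * card V) * T + 4 * (of_nat k * T)"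
    using assms by (simp add: laplacian_norm_sq_mult solid_def)
  then show ?case by (simp add: distrib_right)
next
  case (Suc a)
  let ?F = "norm_sq V ^ Suc a * T"
  have ring: "x * (r * G) + 4 * (y * (r * G)) + r * (z * G) = (x + 4 * y + z) * (r * G)"
    for x y z r G :: cpoly by (simp add: algebra_simps)
  have "laplacian V (norm_sq V ^ Suc (Suc a) * T) = laplacian V (norm_sq V * ?F)"
    by (simp add: mult.assoc)
  also have "\<dots> = of_nat (2 * card V) * ?F + 4 * (of_nat (2 * Suc a + k) * ?F)
      + norm_sq V * (of_nat (2 * Suc a * (2 * a + card V + 2 * k)) * (norm_sq V ^ a * T))"
    by (simp only: laplacian_norm_sq_mult[OF assms(1)] euler_norm_sq_power[OF assms] Suc)
  also have "\<dots> = (of_nat (2 * card V) + 4 * of_nat (2 * Suc a + k)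
      + of_nat (2 * Suc a * (2 * a + card V + 2 * k))) * ?F"
    by (simp only: power_Suc mult.assoc[of "norm_sq V"] ring)
  also have "of_nat (2 * card V) + 4 * of_nat (2 * Suc a + k)
      + of_nat (2 * Suc a * (2 * a + card V + 2 * k))
      = (of_nat (2 * Suc (Suc a) * (2 * Suc a + card V + 2 * k)) :: cpoly)"
    by (simp add: algebra_simps)
  finally show ?case .
qed

text \<open>Moving one |x|^2 across lowers the power on the other side too. This ends when a power
  is exhausted: if only one is, harmonicity gives zero, and if both are, the orthogonality of
  \<open>S\<close> and \<open>T\<close> does.\<close>

lemma fischer_norm_sq_power:
  assumes "finite V" "solid V k S" "solid V l T" "fischer S T = 0"
  shows "fischer (norm_sq V ^ a * S) (norm_sq V ^ c * T) = 0"
proof (induction a arbitrary: c)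
  case 0
  show ?case
  proof (cases c)
    case (Suc c')
    then show ?thesis using assms(2)
      by (subst fischer_commute)
        (simp add: fischer_norm_sq_mult mult.assoc solid_def)
  qed (use assms in simp)
next
  case (Suc a)
  show ?case
  proof (cases c)
    case 0
    then show ?thesis using assms(3)
      by (simp add: fischer_norm_sq_mult mult.assoc solid_def)
  next
    case (Suc c')
    have "fischer (norm_sq V ^ Suc a * S) (norm_sq V ^ c * T)
      = fischer (norm_sq V ^ a * S) (laplacian V (norm_sq V ^ Suc c' * T))"
      by (simp add: fischer_norm_sq_mult mult.assoc Suc del: power_Suc add: power_Suc[of _ a])
    also have "\<dots> = fischer (norm_sq V ^ a * S)
        (single 0 (of_nat (2 * Suc c' * (2 * c' + card V + 2 * l))) * (norm_sq V ^ c' * T))"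
      by (simp only: laplacian_norm_sq_power[OF assms(1,3)] single_of_nat)
    finally show ?thesis by (simp only: fischer_const_mult_right Suc.IH mult_zero_right)
  qed
qed

section \<open>Existence of the Fischer decomposition\<close>

lemma funpow_laplacian_const_mult:
  "(laplacian V ^^ N) (single 0 c * F) = single 0 c * (laplacian V ^^ N) F"
  by (induction N) (simp_all add: laplacian_const_mult)

lemma funpow_laplacian_diff:
  "(laplacian V ^^ N) (F - G) = (laplacian V ^^ N) F - (laplacian V ^^ N) G"
  by (induction N) (simp_all add: laplacian_diff)

lemma polys_laplacian: "P \<in> polys V \<Longrightarrow> laplacian U P \<in> polys V"
  unfolding laplacian_def by (intro polys_sum polys_pd)

lemma funpow_laplacian_polys: "P \<in> polys V \<Longrightarrow> (laplacian V ^^ N) P \<in> polys V"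
  by (induction N) (simp_all add: polys_laplacian)

lemma funpow_laplacian_homogeneous:
  "homogeneous n P \<Longrightarrow> homogeneous (n - 2 * N) ((laplacian V ^^ N) P)"
  by (induction N) (auto dest: homogeneous_laplacian)

text \<open>Each Laplacian contributes a factor that is positive because the dimension is. So on
  solid polynomials multiplication by |x|^(2N) can be undone.\<close>

lemma funpow_laplacian_norm_sq_power:
  assumes "finite V" "V \<noteq> {}" "solid V k T"
  shows "\<exists>c>0. (laplacian V ^^ N) (norm_sq V ^ N * T) = of_nat c * T"
proof (induction N)
  case 0
  show ?case by (rule exI[of _ 1]) simp
next
  case (Suc N)
  then obtain c where c: "c > 0" "(laplacian V ^^ N) (norm_sq V ^ N * T) = of_nat c * T" by blast
  let ?d = "2 * Suc N * (2 * N + card V + 2 * k)"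
  have "(laplacian V ^^ Suc N) (norm_sq V ^ Suc N * T)
    = (laplacian V ^^ N) (single 0 (of_nat ?d) * (norm_sq V ^ N * T))"
    by (simp only: funpow_Suc_right o_apply laplacian_norm_sq_power[OF assms(1,3)] single_of_nat)
  also have "\<dots> = single 0 (of_nat ?d) * (of_nat c * T)"
    by (simp only: funpow_laplacian_const_mult c(2))
  also have "\<dots> = of_nat (?d * c) * T"
    by (simp only: single_of_nat of_nat_mult[of ?d c] mult.assoc[of "of_nat ?d"])
  finally have "(laplacian V ^^ Suc N) (norm_sq V ^ Suc N * T) = of_nat (?d * c) * T" .
  moreover have "?d * c > 0"
    using assms(1,2) c(1) by (simp add: card_gt_0_iff)
  ultimately show ?case by blast
qed

text \<open>Induction on the number of Laplacians that annihilate \<open>f\<close>. If N + 1 do,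
  then g = \<Delta>^N f is harmonic, and subtracting a suitable multiple of |x|^(2N) g leaves a
  polynomial annihilated by N of them.\<close>

lemma fischer_decomposition_aux:
  assumes V: "finite V" "V \<noteq> {}"
  shows "f \<in> polys V \<Longrightarrow> homogeneous n f \<Longrightarrow> N \<le> n div 2 + 1 \<Longrightarrow> (laplacian V ^^ N) f = 0 \<Longrightarrow>
    \<exists>H. (\<forall>s<N. H s \<in> harm_hom V (n - 2 * s)) \<and> f = (\<Sum>s<N. norm_sq V ^ s * H s)"
proof (induction N arbitrary: f)
  case (Suc N)
  define g where "g = (laplacian V ^^ N) f"
  have g: "g \<in> harm_hom V (n - 2 * N)"
    using Suc.prems by (simp add: g_def harm_hom_def harm_def funpow_laplacian_polys
        funpow_laplacian_homogeneous)
  obtain c where c: "c > 0" "(laplacian V ^^ N) (norm_sq V ^ N * g) = of_nat c * g"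
    using funpow_laplacian_norm_sq_power[OF V solid_harm_hom[OF V(1) g]] by blast
  define h where "h = single 0 (1 / of_nat c) * g"
  have h: "h \<in> harm_hom V (n - 2 * N)"
    using g by (simp add: h_def harm_hom_def harm_def polys_mult laplacian_const_mult
        homogeneous_const_mult)
  have "(laplacian V ^^ N) (norm_sq V ^ N * h)
      = (laplacian V ^^ N) (single 0 (1 / of_nat c) * (norm_sq V ^ N * g))"
    by (simp add: h_def mult.left_commute)
  also have "\<dots> = single 0 (1 / of_nat c) * (single 0 (of_nat c) * g)"
    by (simp only: funpow_laplacian_const_mult c(2) single_of_nat)
  also have "\<dots> = g"
    using c(1) by (simp add: mult_single flip: mult.assoc del: single_of_nat)
  finally have lap: "(laplacian V ^^ N) (f - norm_sq V ^ N * h) = 0"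
    by (simp add: funpow_laplacian_diff g_def)
  \<comment> \<open>The bound on \<open>Suc N\<close> gives 2N \<le> n, so the truncated degree n -
    2N is the true one.\<close>
  have deg: "N * 2 + (n - 2 * N) = n" using Suc.prems(3) by auto
  have "homogeneous (N * 2 + (n - 2 * N)) (norm_sq V ^ N * h)"
    using h by (intro homogeneous_mult homogeneous_power) (auto simp: harm_hom_def)
  then have hom: "homogeneous n (norm_sq V ^ N * h)" by (simp only: deg)
  have pol: "norm_sq V ^ N * h \<in> polys V"
    using h by (intro polys_mult polys_power) (auto simp: harm_hom_def harm_def)
  obtain H where H: "\<forall>s<N. H s \<in> harm_hom V (n - 2 * s)"
      "f - norm_sq V ^ N * h = (\<Sum>s<N. norm_sq V ^ s * H s)"
    using Suc.IH[OF polys_diff[OF Suc.prems(1) pol] homogeneous_diff[OF Suc.prems(2) hom] _ lap]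
      Suc.prems(3) by auto
  show ?case
  proof (intro exI conjI)
    show "\<forall>s<Suc N. (H(N := h)) s \<in> harm_hom V (n - 2 * s)"
      using H(1) h by (auto simp: less_Suc_eq)
    show "f = (\<Sum>s<Suc N. norm_sq V ^ s * (H(N := h)) s)"
      using H(2) by (simp add: algebra_simps)
  qed
qed simp

lemma fischer_decomposition_homogeneous:
  assumes "finite V" "V \<noteq> {}" "f \<in> polys V" "homogeneous n f"
  obtains H where "\<And>s. s \<le> n div 2 \<Longrightarrow> H s \<in> harm_hom V (n - 2 * s)"
    "f = (\<Sum>s\<le>n div 2. norm_sq V ^ s * H s)"
proof -
  \<comment> \<open>After n div 2 Laplacians the degree is 0 or 1; one more gives zero.\<close>
  have "(laplacian V ^^ Suc (n div 2)) f = 0"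
    using laplacian_eq_0[OF funpow_laplacian_homogeneous[OF assms(4)], of "n div 2" V] by simp
  then obtain H where "\<forall>s<Suc (n div 2). H s \<in> harm_hom V (n - 2 * s)"
    "f = (\<Sum>s<Suc (n div 2). norm_sq V ^ s * H s)"
    using fischer_decomposition_aux[OF assms, of "Suc (n div 2)"] by auto
  then show thesis
    using that[of H] by (simp add: lessThan_Suc_atMost less_Suc_eq_le)
qed

section \<open>The inhomogeneous decomposition, its uniqueness and the projection\<close>

lemma harm_zero [simp]: "0 \<in> harm V"
  by (simp add: harm_def)

lemma harm_add: "P \<in> harm V \<Longrightarrow> Q \<in> harm V \<Longrightarrow> P + Q \<in> harm V"
  by (simp add: harm_def polys_add laplacian_add)

lemma harm_diff: "P \<in> harm V \<Longrightarrow> Q \<in> harm V \<Longrightarrow> P - Q \<in> harm V"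
  by (simp add: harm_def polys_diff laplacian_diff)

text \<open>The components are harmonic for every index and zero beyond \<open>N\<close>, so that
  decompositions of different lengths can be padded and added.\<close>

lemma fischer_decomposition:
  assumes "finite V" "V \<noteq> {}" "f \<in> polys V"
  shows "\<exists>(N::nat) H. (\<forall>s. H s \<in> harm V) \<and> (\<forall>s>N. H s = 0) \<and> f = (\<Sum>s\<le>N. norm_sq V ^ s * H s)"
proof (induction f rule: poly_induct)
  case zero
  then show ?case by (intro exI[of _ 0] exI[of _ "\<lambda>_. 0"]) simp
next
  case (single \<alpha> c)
  have "single \<alpha> c \<in> polys V" using single assms(3) by (auto simp: polys_def)
  moreover have "homogeneous (expdeg \<alpha>) (single \<alpha> c)"
    by (auto simp: homogeneous_iff lookup_single when_def)
  ultimately obtain H where H: "\<And>s. s \<le> expdeg \<alpha> div 2 \<Longrightarrow> H s \<in> harm_hom V (expdeg \<alpha> - 2 * s)"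
    "single \<alpha> c = (\<Sum>s\<le>expdeg \<alpha> div 2. norm_sq V ^ s * H s)"
    using fischer_decomposition_homogeneous[OF assms(1,2)] by metis
  let ?H = "\<lambda>s. if s \<le> expdeg \<alpha> div 2 then H s else 0"
  show ?case
  proof (intro exI conjI)
    show "\<forall>s. ?H s \<in> harm V" using H(1) by (auto simp: harm_hom_def)
    show "\<forall>s>expdeg \<alpha> div 2. ?H s = 0" by simp
    show "single \<alpha> c = (\<Sum>s\<le>expdeg \<alpha> div 2. norm_sq V ^ s * ?H s)" using H(2) by simp
  qed
next
  case (add f g)
  then obtain M G N H where
    f: "\<forall>s. G s \<in> harm V" "\<forall>s>M. G s = 0" "f = (\<Sum>s\<le>M. norm_sq V ^ s * G s)" and
    g: "\<forall>s. H s \<in> harm V" "\<forall>s>N. H s = 0" "g = (\<Sum>s\<le>N. norm_sq V ^ s * H s)"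
    by blast
  have "f = (\<Sum>s\<le>max M N. norm_sq V ^ s * G s)"
    unfolding f(3) by (rule sum.mono_neutral_left) (use f(2) in auto)
  moreover have "g = (\<Sum>s\<le>max M N. norm_sq V ^ s * H s)"
    unfolding g(3) by (rule sum.mono_neutral_left) (use g(2) in auto)
  ultimately have "f + g = (\<Sum>s\<le>max M N. norm_sq V ^ s * (G s + H s))"
    by (simp add: distrib_left sum.distrib)
  then show ?case
    using f(1,2) g(1,2) by (intro exI[of _ "max M N"] exI[of _ "\<lambda>s. G s + H s"]) (auto intro: harm_add)
qed

lemma harm_norm_sq_mult_eq_0:
  assumes "norm_sq V * G \<in> harm V"
  shows "norm_sq V * G = 0"
proof -
  have "fischer (norm_sq V * G) (norm_sq V * G) = 0"
    using assms unfolding fischer_norm_sq_mult[of V G "norm_sq V * G"] by (simp add: harm_def)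
  then show ?thesis using fischer_self_nonzero by blast
qed

lemma harm_eqI:
  assumes "h \<in> harm V" "h' \<in> harm V" "h + norm_sq V * g = h' + norm_sq V * g'"
  shows "h = h'"
proof -
  have eq: "h - h' = norm_sq V * (g' - g)"
    using assms(3) by (simp add: algebra_simps)
  then have "norm_sq V * (g' - g) \<in> harm V" using harm_diff assms(1,2) by metis
  then show ?thesis using harm_norm_sq_mult_eq_0 eq by fastforce
qed

text \<open>The definite description is unfolded only here; afterwards the projection is recognised
  from a congruence modulo |x|^2. Decomposing the cofactor \<open>g\<close> and shifting the index
  by one turns the congruence into a full decomposition.\<close>

lemma harm_proj_eqI:
  assumes "finite V" "V \<noteq> {}" and h: "h \<in> harm V" and g: "g \<in> polys V"
    and f: "f = h + norm_sq V * g"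
  shows "harm_proj V f = h"
  unfolding harm_proj_def
proof (rule the_equality)
  obtain N H where H: "\<forall>s. H s \<in> harm V" "g = (\<Sum>s\<le>(N::nat). norm_sq V ^ s * H s)"
    using fischer_decomposition[OF assms(1,2) g] by blast
  let ?H = "case_nat h H"
  have "f = (\<Sum>s\<le>Suc N. norm_sq V ^ s * ?H s)"
    unfolding sum.atMost_Suc_shift using f H(2) by (simp add: sum_distrib_left mult.assoc)
  moreover have "\<forall>s\<le>Suc N. ?H s \<in> harm V"
    using H(1) h by (auto split: nat.split)
  ultimately show "\<exists>(N::nat) H. (\<forall>s\<le>N. H s \<in> harm V) \<and> f = (\<Sum>s\<le>N. norm_sq V ^ s * H s) \<and> h = H 0"
    by (intro exI[of _ "Suc N"] exI[of _ ?H]) simp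
next
  fix h' assume "\<exists>(N::nat) H. (\<forall>s\<le>N. H s \<in> harm V) \<and> f = (\<Sum>s\<le>N. norm_sq V ^ s * H s) \<and> h' = H 0"
  then obtain N H where H: "\<forall>s\<le>(N::nat). H s \<in> harm V" "f = (\<Sum>s\<le>N. norm_sq V ^ s * H s)" "h' = H 0"
    by blast
  have "f = h' + norm_sq V * (\<Sum>s<N. norm_sq V ^ s * H (Suc s))"
    unfolding H(2,3) sum.atMost_shift by (simp add: sum_distrib_left mult.assoc)
  then show "h' = h" using H(1,3) h f
    by (intro harm_eqI[of h' V h "\<Sum>s<N. norm_sq V ^ s * H (Suc s)" g]) auto
qed

section \<open>Laplace--Beltrami operators\<close>

lemma angular_add: "angular a b (P + Q) = angular a b P + angular a b Q"
  by (simp add: angular_def pd_add algebra_simps)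

lemma angular_diff: "angular a b (P - Q) = angular a b P - angular a b Q"
  by (simp add: angular_def pd_diff algebra_simps)

lemma angular_zero [simp]: "angular a b 0 = 0"
  by (simp add: angular_def)

lemma angular_sum: "angular a b (\<Sum>i\<in>A. f i) = (\<Sum>i\<in>A. angular a b (f i))"
  by (induction A rule: infinite_finite_induct) (simp_all add: angular_add)

lemma angular_mult: "angular a b (P * Q) = angular a b P * Q + P * angular a b Q"
  by (simp add: angular_def pd_mult algebra_simps)

lemma angular_power: "angular a b P = 0 \<Longrightarrow> angular a b (P ^ n) = 0"
  by (induction n) (simp_all add: angular_mult, simp add: angular_def)

text \<open>Either the rotation acts inside \<open>A\<close>, or it does not touch the variables of
  \<open>A\<close>. The same alternative governs the commutation facts below.\<close>

lemma angular_norm_sq: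
  "finite A \<Longrightarrow> (a \<in> A \<longleftrightarrow> b \<in> A) \<Longrightarrow> angular a b (norm_sq A) = 0"
  by (simp add: angular_def pd_norm_sq mult.left_commute mult.commute)

lemma pd_euler:
  assumes "finite A"
  shows "pd b (euler A P) = (if b \<in> A then pd b P else 0) + euler A (pd b P)"
proof -
  have "pd b (euler A P) = (\<Sum>j\<in>A. (if b = j then pd b P else 0) + X j * pd j (pd b P))"
    unfolding euler_def pd_sum
    by (intro sum.cong refl) (simp add: pd_mult pd_X pd_commute[of b])
  then show ?thesis using assms by (simp add: sum.distrib euler_def)
qed

lemma euler_X_mult:
  assumes "finite A"
  shows "euler A (X a * F) = (if a \<in> A then X a * F else 0) + X a * euler A F"
proof -
  have "euler A (X a) = (\<Sum>j\<in>A. if a = j then X a else 0)"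
    unfolding euler_def by (intro sum.cong refl) (simp add: pd_X)
  then show ?thesis using assms by (simp add: euler_mult)
qed

lemma euler_diff: "euler A (P - Q) = euler A P - euler A Q"
  by (simp add: euler_def pd_diff sum_subtractf right_diff_distrib)

lemma pd_laplacian: "pd b (laplacian A P) = laplacian A (pd b P)"
  unfolding laplacian_def pd_sum by (intro sum.cong refl) (simp add: pd_commute[of b])

lemma laplacian_X_mult:
  assumes "finite A"
  shows "laplacian A (X a * F) = (if a \<in> A then 2 * pd a F else 0) + X a * laplacian A F"
proof -
  have "laplacian A (X a * F) = (\<Sum>j\<in>A. (if a = j then 2 * pd a F else 0) + X a * pd j (pd j F))"
    unfolding laplacian_def by (intro sum.cong refl) (simp add: pd_mult pd_add pd_X)
  then show ?thesis using assms by (simp add: sum.distrib sum_distrib_left laplacian_def)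
qed

lemma angular_euler:
  "finite A \<Longrightarrow> (a \<in> A \<longleftrightarrow> b \<in> A) \<Longrightarrow> angular a b (euler A P) = euler A (angular a b P)"
  by (simp add: angular_def pd_euler euler_X_mult euler_diff algebra_simps)

lemma angular_laplacian:
  "finite A \<Longrightarrow> (a \<in> A \<longleftrightarrow> b \<in> A) \<Longrightarrow> angular a b (laplacian A P) = laplacian A (angular a b P)"
  by (simp add: angular_def pd_laplacian laplacian_X_mult laplacian_diff pd_commute[of a])

text \<open>The last summand corrects the diagonal, where the left side is zero, so that the formula
  can be summed over all pairs.\<close>

lemma angular_angular:
  "angular a b (angular a b P) = X a ^ 2 * pd b (pd b P) + X b ^ 2 * pd a (pd a P)
    - X a * pd a P - X b * pd b P - 2 * (X a * (X b * pd a (pd b P)))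
    + (if a = b then 2 * (X a * pd a P) else 0)"
  by (cases "a = b")
    (simp_all add: angular_def pd_diff pd_mult pd_X pd_commute[of b a] power2_eq_square algebra_simps)

text \<open>The square of \<open>angular a b\<close> is symmetric in the indices and vanishes on the
  diagonal. Sums over all pairs factor into products, which sums over ordered pairs do not.\<close>

lemma laplace_beltrami_double:
  assumes "finite V"
  shows "2 * laplace_beltrami V P = (\<Sum>a\<in>V. \<Sum>b\<in>V. angular a b (angular a b P))"
proof -
  let ?f = "\<lambda>(a, b). angular a b (angular a b P)"
  let ?L = "{(a, b). a \<in> V \<and> b \<in> V \<and> a < b}"
  let ?G = "{(a, b). a \<in> V \<and> b \<in> V \<and> b < a}"
  let ?D = "{(a, b). a \<in> V \<and> b \<in> V \<and> a = b}"
  have fin: "finite ?L" "finite ?G" "finite ?D"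
    by (rule finite_subset[of _ "V \<times> V"]; use assms in auto)+
  have "(\<Sum>a\<in>V. \<Sum>b\<in>V. angular a b (angular a b P)) = sum ?f (V \<times> V)"
    by (simp add: sum.cartesian_product)
  also have "V \<times> V = ?L \<union> (?G \<union> ?D)" by auto
  also have "sum ?f \<dots> = sum ?f ?L + (sum ?f ?G + sum ?f ?D)"
    using fin by (subst sum.union_disjoint; (subst sum.union_disjoint)?) auto
  also have "sum ?f ?D = 0"
    by (intro sum.neutral) (auto simp: angular_def)
  also have "sum ?f ?G = sum ?f ?L"
    by (rule sum.reindex_bij_witness[of _ prod.swap prod.swap])
      (auto simp: angular_def pd_diff algebra_simps)
  finally show ?thesis by (simp add: laplace_beltrami_def)
qed

text \<open>The Casimir identity |x|^2 \<Delta> - E(E + d - 2). It reduces invariance and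
  eigenvalues to those of |x|^2, the Laplacian and E.\<close>

lemma laplace_beltrami_eq:
  assumes "finite V"
  shows "laplace_beltrami V P
    = norm_sq V * laplacian V P - euler V (euler V P) - (of_nat (card V) - 2) * euler V P"
proof -
  \<comment> \<open>This sum is E(E - 1): taking the outer Euler operator past the inner variable
    costs one extra E.\<close>
  let ?M = "\<Sum>a\<in>V. \<Sum>b\<in>V. X a * (X b * pd a (pd b P))"
  have "euler V (euler V P) = (\<Sum>a\<in>V. X a * pd a P + X a * (\<Sum>b\<in>V. X b * pd a (pd b P)))"
    unfolding euler_def[of V "euler V P"]
    by (intro sum.cong refl) (simp add: pd_euler[OF assms] distrib_left, simp add: euler_def pd_commute)
  then have M: "euler V (euler V P) = euler V P + ?M"
    by (simp add: sum.distrib euler_def sum_distrib_left)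
  have "2 * laplace_beltrami V P = norm_sq V * laplacian V P + norm_sq V * laplacian V P
      - of_nat (card V) * euler V P - of_nat (card V) * euler V P - 2 * ?M + 2 * euler V P"
    using assms
    by (simp add: laplace_beltrami_double angular_angular sum.distrib sum_subtractf
        norm_sq_def laplacian_def euler_def sum_distrib_left sum_distrib_right sum_product
        sum.swap[of "\<lambda>a b. X b ^ 2 * pd a (pd a P)" V V])
  also have "\<dots> = 2 * (norm_sq V * laplacian V P - euler V (euler V P)
      - (of_nat (card V) - 2) * euler V P)"
    unfolding M by (simp add: algebra_simps)
  finally show ?thesis by (simp only: mult_cancel_left) simp
qed

lemma angular_laplace_beltrami:
  assumes "finite A" "a \<in> A \<longleftrightarrow> b \<in> A"
  shows "angular a b (laplace_beltrami A P) = laplace_beltrami A (angular a b P)"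
proof -
  have "angular a b (of_nat (card A) - 2) = 0" by (simp add: angular_def pd_diff)
  then show ?thesis
    using assms by (simp add: laplace_beltrami_eq angular_diff angular_mult angular_norm_sq
        angular_euler angular_laplacian)
qed

lemma laplace_beltrami_sum: "laplace_beltrami V (\<Sum>i\<in>A. f i) = (\<Sum>i\<in>A. laplace_beltrami V (f i))"
  unfolding laplace_beltrami_def angular_sum
  by (subst sum.swap) (simp add: case_prod_unfold)

text \<open>Every plane of rotation in \<open>B\<close> lies within the variables of
  \<open>A\<close> or avoids them, so each squared rotation commutes with the operator of
  \<open>A\<close>.\<close>

lemma laplace_beltrami_commute:
  assumes "finite A" "B \<subseteq> A \<or> B \<inter> A = {}"
  shows "laplace_beltrami B (laplace_beltrami A P) = laplace_beltrami A (laplace_beltrami B P)"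
proof -
  have iff: "a \<in> A \<longleftrightarrow> b \<in> A" if "a \<in> B" "b \<in> B" for a b
    using assms(2) that by blast
  have "laplace_beltrami B (laplace_beltrami A P)
    = (\<Sum>x\<in>{(a, b). a \<in> B \<and> b \<in> B \<and> a < b}.
        laplace_beltrami A (case x of (a, b) \<Rightarrow> angular a b (angular a b P)))"
    unfolding laplace_beltrami_def[of B]
    by (intro sum.cong refl) (auto simp: angular_laplace_beltrami[OF assms(1) iff])
  then show ?thesis
    by (simp add: laplace_beltrami_def[of B] laplace_beltrami_sum)
qed

lemma laplace_beltrami_mult_left:
  assumes "\<And>a b. a \<in> V \<Longrightarrow> b \<in> V \<Longrightarrow> angular a b G = 0"
  shows "laplace_beltrami V (G * F) = G * laplace_beltrami V F"
  unfolding laplace_beltrami_def sum_distrib_left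
  by (intro sum.cong refl) (use assms in \<open>auto simp: angular_mult\<close>)

lemma laplace_beltrami_solid:
  assumes "finite V" "solid V k T"
  shows "laplace_beltrami V T = of_int (LB_eigenvalue (card V) k) * T"
proof -
  have T: "laplacian V T = 0" "euler V T = of_nat k * T"
    using assms(2) by (simp_all add: solid_def)
  have "euler V (of_nat k * T) = of_nat k * (of_nat k * T)"
    by (subst euler_mult_left) (simp_all add: T)
  then show ?thesis
    by (simp add: laplace_beltrami_eq[OF assms(1)] T LB_eigenvalue_def algebra_simps)
qed

section \<open>Harmonic projection along an orthogonal splitting\<close>

lemma laplacian_union:
  "finite U \<Longrightarrow> finite V \<Longrightarrow> U \<inter> V = {} \<Longrightarrow> laplacian (U \<union> V) P = laplacian U P + laplacian V P"
  by (simp add: laplacian_def sum.union_disjoint)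

lemma norm_sq_union:
  "finite U \<Longrightarrow> finite V \<Longrightarrow> U \<inter> V = {} \<Longrightarrow> norm_sq (U \<union> V) = norm_sq U + norm_sq V"
  by (simp add: norm_sq_def sum.union_disjoint)

lemma norm_sq_nonzero:
  assumes "finite V" "V \<noteq> {}" shows "norm_sq V \<noteq> 0"
proof
  assume "norm_sq V = 0"
  then have "laplacian V (norm_sq V * 1) = 0" by simp
  moreover have "laplacian V (norm_sq V * 1) = of_nat (2 * card V)"
    by (simp only: laplacian_norm_sq_mult[OF assms(1)]) (simp add: euler_def laplacian_def)
  ultimately show False using assms by (simp only: of_nat_eq_0_iff) simp
qed

lemma sum_single: "(\<Sum>i\<in>A. single \<alpha> (f i)) = single \<alpha> (\<Sum>i\<in>A. f i)"
  by (induction A rule: infinite_finite_induct) (simp_all add: single_add)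

locale orthogonal_split =
  fixes U V W :: "nat set"
  assumes fin: "finite U" "finite V" and nonempty: "U \<noteq> {}" "V \<noteq> {}"
    and disjoint: "U \<inter> V = {}" and W: "W = U \<union> V"
begin

lemma finite_W: "finite W" and W_nonempty: "W \<noteq> {}" and subset_W: "U \<subseteq> W" "V \<subseteq> W"
  using fin nonempty W by auto

lemma norm_sq_W: "norm_sq W = norm_sq U + norm_sq V"
  using fin disjoint W norm_sq_union by simp

lemma laplacian_W: "laplacian W P = laplacian U P + laplacian V P"
  using fin disjoint W laplacian_union by simp

lemma pd_norm_sq_U_power: "j \<in> V \<Longrightarrow> pd j (norm_sq U ^ a) = 0"
  and pd_norm_sq_V_power: "j \<in> U \<Longrightarrow> pd j (norm_sq V ^ a) = 0"
  by (rule pd_eq_0[of _ U] pd_eq_0[of _ V]; use disjoint in \<open>auto intro: polys_power\<close>)+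

text \<open>Iterates |v|^2 = |x|^2 - |u|^2. The cofactor is kept as a polynomial in the variables
  \<open>W\<close>, as \<open>harm_proj_eqI\<close> demands.\<close>

lemma norm_sq_V_power_cong:
  "\<exists>G\<in>polys W. norm_sq V ^ b = single 0 ((-1) ^ b) * norm_sq U ^ b + norm_sq W * G"
proof (induction b)
  case 0
  show ?case by (rule bexI[of _ 0]) simp_all
next
  case (Suc b)
  then obtain G where G: "G \<in> polys W"
    "norm_sq V ^ b = single 0 ((-1) ^ b) * norm_sq U ^ b + norm_sq W * G" by blast
  let ?c = "single 0 ((-1) ^ b) :: cpoly"
  have c: "single 0 ((-1) ^ Suc b) = - ?c" by (simp flip: single_uminus)
  have V: "norm_sq V = norm_sq W - norm_sq U" by (simp add: norm_sq_W)
  have "norm_sq V ^ Suc b = norm_sq V * (?c * norm_sq U ^ b + norm_sq W * G)"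
    by (simp add: G(2))
  also have "\<dots> = - ?c * norm_sq U ^ Suc b + norm_sq W * (?c * norm_sq U ^ b + norm_sq V * G)"
    by (simp add: V algebra_simps)
  finally have "norm_sq V ^ Suc b = single 0 ((-1) ^ Suc b) * norm_sq U ^ Suc b
      + norm_sq W * (?c * norm_sq U ^ b + norm_sq V * G)" by (simp only: c)
  moreover have "?c * norm_sq U ^ b + norm_sq V * G \<in> polys W"
    using G(1) subset_W by (intro polys_add polys_mult polys_power) auto
  ultimately show ?case by blast
qed

text \<open>\<open>laplacian U\<close> removes a factor |u|^2 from each term and
  \<open>laplacian V\<close> a factor |v|^2. So harmonicity is one linear equation for each term of
  total power s - 1. That \<open>c s\<close> is nonzero later shows that the combination does not
  vanish.\<close>

lemma harmonic_combination:
  assumes U: "solid U k T" and V: "solid V i T"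
  shows "\<exists>c. c s \<noteq> 0 \<and>
    laplacian W (\<Sum>a\<le>s. single 0 (c a) * (norm_sq U ^ a * (norm_sq V ^ (s - a) * T))) = 0"
proof -
  define \<alpha> where "\<alpha> a = (of_nat (2 * Suc a * (2 * a + card U + 2 * k)) :: complex)" for a
  define \<beta> where "\<beta> b = (of_nat (2 * Suc b * (2 * b + card V + 2 * i)) :: complex)" for b
  \<comment> \<open>The coefficient of |u|^(2a) |v|^(2(s-1-a)) T in the Laplacian is c(a+1)
    \<alpha>(a) + c(a) \<beta>(s-1-a); the recursion makes it zero. Only a < s matters, where
    \<open>s - Suc a\<close> is not truncated.\<close>
  define c where "c = rec_nat 1 (\<lambda>a x. - x * \<beta> (s - Suc a) / \<alpha> a)"
  have card: "card U > 0" "card V > 0"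
    using fin nonempty by (simp_all add: card_gt_0_iff)
  have nz: "\<alpha> a \<noteq> 0" "\<beta> a \<noteq> 0" for a
    unfolding \<alpha>_def \<beta>_def of_nat_eq_0_iff using card by simp_all
  have c_Suc: "c (Suc a) * \<alpha> a = - c a * \<beta> (s - Suc a)" for a
    using nz by (simp add: c_def)
  have c_nz: "c a \<noteq> 0" for a
    by (induction a) (use nz in \<open>simp_all add: c_def\<close>)
  let ?F = "\<lambda>a b. norm_sq U ^ a * (norm_sq V ^ b * T)"
  have solid_U: "solid U k (norm_sq V ^ b * T)" for b
    using U pd_norm_sq_V_power by (rule solid_mult_left[rotated])
  have lap_U: "laplacian U (?F (Suc a) b) = single 0 (\<alpha> a) * ?F a b" for a b
    unfolding \<alpha>_def single_of_nat by (rule laplacian_norm_sq_power[OF fin(1) solid_U])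
  have lap_U0: "laplacian U (?F 0 b) = 0" for b
    using solid_U[of b] by (simp add: solid_def)
  have lap_V: "laplacian V (?F a (Suc b)) = single 0 (\<beta> b) * ?F a b" for a b
    unfolding \<beta>_def single_of_nat
    by (subst laplacian_mult_left[OF pd_norm_sq_U_power], assumption)
      (simp only: laplacian_norm_sq_power[OF fin(2) V] mult.left_commute)
  have lap_V0: "laplacian V (?F a 0) = 0" for a
    using V by (subst laplacian_mult_left[OF pd_norm_sq_U_power]) (simp_all add: solid_def)
  \<comment> \<open>The term without |u|^2 drops out here, the term without |v|^2 in the next sum;
    after the shift both run over the same products.\<close>
  have "(\<Sum>a\<le>s. laplacian U (single 0 (c a) * ?F a (s - a)))
    = (\<Sum>a<s. single 0 (c (Suc a)) * (single 0 (\<alpha> a) * ?F a (s - Suc a)))"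
    unfolding sum.atMost_shift laplacian_const_mult lap_U0 lap_U by simp
  moreover have "(\<Sum>a\<le>s. laplacian V (single 0 (c a) * ?F a (s - a)))
    = (\<Sum>a<s. single 0 (c a) * (single 0 (\<beta> (s - Suc a)) * ?F a (s - Suc a)))"
  proof -
    have "(\<Sum>a\<le>s. laplacian V (single 0 (c a) * ?F a (s - a)))
      = (\<Sum>a<s. laplacian V (single 0 (c a) * ?F a (s - a)))"
      by (simp add: lessThan_Suc_atMost[symmetric] laplacian_const_mult lap_V0[simplified])
    also have "\<dots> = (\<Sum>a<s. single 0 (c a) * (single 0 (\<beta> (s - Suc a)) * ?F a (s - Suc a)))"
      by (intro sum.cong refl) (simp add: laplacian_const_mult Suc_diff_Suc flip: lap_V)
    finally show ?thesis .
  qed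
  ultimately have "laplacian W (\<Sum>a\<le>s. single 0 (c a) * ?F a (s - a))
    = (\<Sum>a<s. single 0 (c (Suc a)) * (single 0 (\<alpha> a) * ?F a (s - Suc a))
        + single 0 (c a) * (single 0 (\<beta> (s - Suc a)) * ?F a (s - Suc a)))"
    by (simp only: laplacian_W laplacian_sum sum.distrib)
  also have "\<dots> = 0"
  proof (intro sum.neutral ballI)
    fix a
    have "single 0 (c (Suc a)) * (single 0 (\<alpha> a) * P) + single 0 (c a) * (single 0 (\<beta> (s - Suc a)) * P)
      = single 0 (c (Suc a) * \<alpha> a + c a * \<beta> (s - Suc a)) * P" for P :: cpoly
      by (simp only: mult.assoc[symmetric] mult_single single_add distrib_right add_0)
    then show "single 0 (c (Suc a)) * (single 0 (\<alpha> a) * ?F a (s - Suc a))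
        + single 0 (c a) * (single 0 (\<beta> (s - Suc a)) * ?F a (s - Suc a)) = 0"
      by (simp only: c_Suc) simp
  qed
  finally have "laplacian W (\<Sum>a\<le>s. single 0 (c a) * ?F a (s - a)) = 0" .
  then show ?thesis using c_nz by blast
qed

text \<open>A factor |v|^2 crosses over as \<open>laplacian V\<close>, which passes |u|^(2s) and
  annihilates \<open>T\<close>.\<close>

lemma fischer_norm_sq_U_power:
  assumes "solid V i T" "b > 0"
  shows "fischer (norm_sq U ^ s * T) (norm_sq U ^ a * (norm_sq V ^ b * T')) = 0"
proof -
  obtain b' where b: "b = Suc b'" using assms(2) gr0_implies_Suc by blast
  have "fischer (norm_sq V * (norm_sq U ^ a * (norm_sq V ^ b' * T'))) (norm_sq U ^ s * T) = 0"
    unfolding fischer_norm_sq_mult using assms(1)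
    by (subst laplacian_mult_left[OF pd_norm_sq_U_power]) (simp_all add: solid_def)
  then show ?thesis
    by (subst fischer_commute) (simp add: b mult_ac)
qed

text \<open>The last conclusion keeps the congruence modulo |x|^2 available for the spanning
  argument.\<close>

lemma harm_proj_norm_sq_power:
  assumes U: "solid U k T" and V: "solid V i T" and T: "T \<in> polys W" "homogeneous d T" "T \<noteq> 0"
  obtains c where
    "harm_proj W (norm_sq U ^ s * T)
      = (\<Sum>a\<le>s. single 0 (c a) * (norm_sq U ^ a * (norm_sq V ^ (s - a) * T)))"
    "harm_proj W (norm_sq U ^ s * T) \<noteq> 0"
    "harm_proj W (norm_sq U ^ s * T) \<in> harm_hom W (2 * s + d)"
    "\<exists>G\<in>polys W. norm_sq U ^ s * T = harm_proj W (norm_sq U ^ s * T) + norm_sq W * G"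
proof -
  let ?f = "norm_sq U ^ s * T"
  let ?F = "\<lambda>a b. norm_sq U ^ a * (norm_sq V ^ b * T)"
  obtain c where c: "c s \<noteq> 0" "laplacian W (\<Sum>a\<le>s. single 0 (c a) * ?F a (s - a)) = 0"
    using harmonic_combination[OF U V] by blast
  define h where "h = (\<Sum>a\<le>s. single 0 (c a) * ?F a (s - a))"
  have F_polys: "?F a b \<in> polys W" for a b
    using T subset_W by (intro polys_mult polys_power) auto
  have "h \<in> polys W" unfolding h_def by (intro polys_sum polys_mult F_polys) simp
  then have h_harm: "h \<in> harm W" using c(2) by (simp add: harm_def h_def)
  have "homogeneous (2 * s + d) h" unfolding h_def
  proof (intro homogeneous_sum homogeneous_const_mult)
    fix a assume "a \<in> {..s}"
    then have "2 * s + d = a * 2 + ((s - a) * 2 + d)" by auto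
    then show "homogeneous (2 * s + d) (?F a (s - a))"
      using T(2) by (simp only:) (intro homogeneous_mult homogeneous_power homogeneous_norm_sq)
  qed
  then have h_hom: "h \<in> harm_hom W (2 * s + d)"
    using h_harm by (simp add: harm_hom_def)
  \<comment> \<open>Pairing with |u|^(2s) T retains only the summand a = s, the one without |v|^2,
    and so detects that \<open>h\<close> is nonzero.\<close>
  have "fischer ?f h = (\<Sum>a\<le>s. c a * fischer ?f (?F a (s - a)))"
    by (simp add: h_def fischer_sum_right fischer_const_mult_right)
  also have "\<dots> = (\<Sum>a\<le>s. if a = s then c s * fischer ?f ?f else 0)"
    by (intro sum.cong refl) (auto simp: fischer_norm_sq_U_power[OF V])
  finally have "fischer ?f h = c s * fischer ?f ?f" by simp
  moreover have "?f \<noteq> 0" using T(3) norm_sq_nonzero[OF fin(1) nonempty(1)] by simp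
  ultimately have h_nz: "h \<noteq> 0" using c(1) fischer_self_nonzero[of ?f] by auto
  obtain G where G: "\<And>b. G b \<in> polys W"
    "\<And>b. norm_sq V ^ b = single 0 ((-1) ^ b) * norm_sq U ^ b + norm_sq W * G b"
    using norm_sq_V_power_cong by metis
  \<comment> \<open>\<open>C\<close> is the factor left when |v|^2 is replaced by -|u|^2 in the
    combination; \<open>K\<close> collects the resulting multiples of |x|^2.\<close>
  define C where "C = (\<Sum>a\<le>s. c a * (-1) ^ (s - a))"
  define K where "K = (\<Sum>a\<le>s. single 0 (c a) * (norm_sq U ^ a * (G (s - a) * T)))"
  have K: "K \<in> polys W" unfolding K_def
    using T(1) G(1) subset_W by (intro polys_sum polys_mult polys_power) auto
  have "h = (\<Sum>a\<le>s. single 0 (c a * (-1) ^ (s - a)) * ?f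
      + norm_sq W * (single 0 (c a) * (norm_sq U ^ a * (G (s - a) * T))))"
    unfolding h_def
  proof (intro sum.cong refl)
    fix a assume "a \<in> {..s}"
    then have s: "norm_sq U ^ s = norm_sq U ^ a * norm_sq U ^ (s - a)"
      by (simp flip: power_add)
    have s': "single 0 (c a * (-1) ^ (s - a)) = single 0 (c a) * single 0 ((-1) ^ (s - a))"
      by (simp add: mult_single)
    show "single 0 (c a) * ?F a (s - a) = single 0 (c a * (-1) ^ (s - a)) * ?f
      + norm_sq W * (single 0 (c a) * (norm_sq U ^ a * (G (s - a) * T)))"
      unfolding s s' G(2)[of "s - a"] by (simp only: distrib_left distrib_right mult_ac)
  qed
  moreover have "(\<Sum>a\<le>s. single 0 (c a * (-1) ^ (s - a))) = (single 0 C :: cpoly)"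
    by (simp add: C_def sum_single)
  ultimately have h: "h = single 0 C * ?f + norm_sq W * K"
    by (simp add: sum.distrib K_def sum_distrib_left flip: sum_distrib_right)
  \<comment> \<open>Otherwise \<open>h\<close> would be a nonzero harmonic multiple of
    |x|^2.\<close>
  have C: "C \<noteq> 0"
  proof
    assume "C = 0"
    then have "h = norm_sq W * K" using h by simp
    then show False using harm_norm_sq_mult_eq_0 h_harm h_nz by metis
  qed
  let ?B = "single 0 (1 / C) * h"
  have unit: "single 0 (1 / C) * (single 0 C * P) = P" for P :: cpoly
    using C by (simp add: mult_single flip: mult.assoc)
  have f: "?f = ?B + norm_sq W * (- (single 0 (1 / C) * K))"
    unfolding h distrib_left unit by (simp add: mult.left_commute)
  have B: "?B \<in> harm_hom W (2 * s + d)"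
    using h_hom by (simp add: harm_hom_def harm_def polys_mult homogeneous_const_mult
        laplacian_const_mult)
  have K': "- (single 0 (1 / C) * K) \<in> polys W"
    using K by (intro polys_uminus polys_mult) auto
  have proj: "harm_proj W ?f = ?B"
    using B K' f by (intro harm_proj_eqI finite_W W_nonempty) (auto simp: harm_hom_def)
  show thesis
  proof (rule that[of "\<lambda>a. 1 / C * c a"]; unfold proj)
    show "?B = (\<Sum>a\<le>s. single 0 (1 / C * c a) * ?F a (s - a))"
      by (simp add: h_def sum_distrib_left mult_single flip: mult.assoc)
    show "?B \<noteq> 0" using unit[of h] h_nz C by auto
    show "?B \<in> harm_hom W (2 * s + d)" by (rule B)
    show "\<exists>G\<in>polys W. ?f = ?B + norm_sq W * G" using f K' by blast
  qed
qed

end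

section \<open>Criteria for independence and for membership in a subspace\<close>

lemma orthogonal_family_independent:
  assumes orth: "orthogonal_family B I" and nz: "\<And>a. a \<in> I \<Longrightarrow> B a \<noteq> 0"
  shows "inj_on B I" "cpoly.independent (B ` I)"
proof -
  show "inj_on B I"
  proof (rule inj_onI, rule ccontr)
    fix a b assume ab: "a \<in> I" "b \<in> I" "B a = B b" "a \<noteq> b"
    then have "fischer (B a) (B a) = 0" using orth unfolding orthogonal_family_def by metis
    then show False using fischer_self_nonzero nz ab(1) by blast
  qed
  show "cpoly.independent (B ` I)"
    unfolding cpoly.dependent_explicit
  proof (rule notI, elim exE conjE bexE)
    fix t u v
    assume t: "finite t" "t \<subseteq> B ` I" "(\<Sum>w\<in>t. cscale (u w) w) = 0" and v: "v \<in> t" "u v \<noteq> 0"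
    have "0 = fischer v (\<Sum>w\<in>t. cscale (u w) w)" using t(3) by simp
    also have "\<dots> = (\<Sum>w\<in>t. u w * fischer v w)"
      by (simp add: fischer_sum_right cscale_def fischer_const_mult_right)
    also have "\<dots> = (\<Sum>w\<in>t. if w = v then u v * fischer v v else 0)"
    proof (intro sum.cong refl)
      fix w assume w: "w \<in> t"
      obtain x where x: "x \<in> I" "v = B x" using subsetD[OF t(2) v(1)] by (rule imageE)
      obtain y where y: "y \<in> I" "w = B y" using subsetD[OF t(2) w] by (rule imageE)
      have "fischer v w = 0" if "w \<noteq> v"
        using orth x y that unfolding orthogonal_family_def by (cases "x = y") simp_all
      then show "u w * fischer v w = (if w = v then u v * fischer v v else 0)" by simp
    qed
    also have "\<dots> = u v * fischer v v" using t(1) v(1) by simp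
    finally have "v = 0" using v(2) fischer_self_nonzero by auto
    moreover have "v \<noteq> 0" using subsetD[OF t(2) v(1)] by (rule imageE) (simp add: nz)
    ultimately show False by simp
  qed
qed

lemma subspace_harm_hom: "cpoly.subspace (harm_hom V k)"
  by (rule cpoly.subspaceI)
    (auto simp: harm_hom_def harm_def cscale_def polys_add polys_mult laplacian_add
      laplacian_const_mult homogeneous_add homogeneous_const_mult)

text \<open>Allows membership of products to be extended from a basis to its span, one factor at a
  time.\<close>

lemma subspace_mult_left:
  assumes "cpoly.subspace Z" shows "cpoly.subspace {x. G * x \<in> Z}"
proof (rule cpoly.subspaceI)
  fix c x assume "x \<in> {x. G * x \<in> Z}"
  then have "cscale c (G * x) \<in> Z" using assms cpoly.subspace_scale by blast
  then show "cscale c x \<in> {x. G * x \<in> Z}" by (simp add: cscale_def mult.left_commute)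
qed (use assms cpoly.subspace_add cpoly.subspace_0 in \<open>auto simp: distrib_left\<close>)

context orthogonal_split
begin

lemma exponent_split:
  "keys \<alpha> \<subseteq> W \<Longrightarrow> \<exists>\<beta> \<gamma>. keys \<beta> \<subseteq> U \<and> keys \<gamma> \<subseteq> V \<and> \<alpha> = \<beta> + (\<gamma> :: nat \<Rightarrow>\<^sub>0 nat)"
proof (induction \<alpha> rule: exponent_induct)
  case zero
  show ?case by (intro exI[of _ 0]) simp
next
  case (add \<alpha> j)
  then obtain \<beta> \<gamma> where *: "keys \<beta> \<subseteq> U" "keys \<gamma> \<subseteq> V" "\<alpha> = \<beta> + \<gamma>" by blast
  have sub: "keys (\<delta> + single j 1) \<subseteq> A" if "keys \<delta> \<subseteq> A" "j \<in> A" for \<delta> :: "nat \<Rightarrow>\<^sub>0 nat" and A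
    using that keys_add[of \<delta> "single j 1"] by auto
  show ?case
  proof (cases "j \<in> U")
    case True
    then show ?thesis using * sub[of \<beta> U]
      by (intro exI[of _ "\<beta> + single j 1"] exI[of _ \<gamma>]) (auto simp: add_ac)
  next
    case False
    then have "j \<in> V" using add.hyps W by auto
    then show ?thesis using * sub[of \<gamma> V]
      by (intro exI[of _ \<beta>] exI[of _ "\<gamma> + single j 1"]) (auto simp: add_ac)
  qed
qed

text \<open>A single monomial is homogeneous in u and in v separately, so the homogeneous Fischer
  decomposition applies to both factors and the degrees add up to n.\<close>

lemma homogeneous_in_subspace:
  assumes "f \<in> polys W" "homogeneous n f" and Z: "cpoly.subspace Z"
    and mem: "\<And>a b k i S Q. S \<in> harm_hom U k \<Longrightarrow> Q \<in> harm_hom V i \<Longrightarrow> 2 * (a + b) + k + i = n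
      \<Longrightarrow> norm_sq U ^ a * (norm_sq V ^ b * (S * Q)) \<in> Z"
  shows "f \<in> Z"
proof (induction f rule: poly_induct)
  case (single \<alpha> c)
  then have "keys \<alpha> \<subseteq> W" "expdeg \<alpha> = n"
    using assms(1,2) by (auto simp: polys_def homogeneous_iff in_keys_iff)
  then obtain \<beta> \<gamma> where \<alpha>: "keys \<beta> \<subseteq> U" "keys \<gamma> \<subseteq> V" "\<alpha> = \<beta> + \<gamma>" "expdeg \<beta> + expdeg \<gamma> = n"
    using exponent_split expdeg_add by metis
  have hom: "homogeneous (expdeg \<delta>) (single \<delta> d)" for \<delta> d
    by (auto simp: homogeneous_iff lookup_single when_def)
  obtain H where H: "\<And>s. s \<le> expdeg \<beta> div 2 \<Longrightarrow> H s \<in> harm_hom U (expdeg \<beta> - 2 * s)"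
    "single \<beta> 1 = (\<Sum>s\<le>expdeg \<beta> div 2. norm_sq U ^ s * H s)"
    by (rule fischer_decomposition_homogeneous[OF fin(1) nonempty(1) _ hom[of \<beta> 1]])
      (use \<alpha> in \<open>auto simp: polys_def\<close>)
  obtain G where G: "\<And>s. s \<le> expdeg \<gamma> div 2 \<Longrightarrow> G s \<in> harm_hom V (expdeg \<gamma> - 2 * s)"
    "single \<gamma> c = (\<Sum>s\<le>expdeg \<gamma> div 2. norm_sq V ^ s * G s)"
    by (rule fischer_decomposition_homogeneous[OF fin(2) nonempty(2) _ hom[of \<gamma> c]])
      (use \<alpha> in \<open>auto simp: polys_def\<close>)
  have "single \<alpha> c = single \<beta> 1 * single \<gamma> c" by (simp add: \<alpha>(3) mult_single)
  also have "\<dots> = (\<Sum>s\<le>expdeg \<beta> div 2. \<Sum>t\<le>expdeg \<gamma> div 2.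
      norm_sq U ^ s * (norm_sq V ^ t * (H s * G t)))"
    unfolding H(2) G(2) sum_product by (simp only: mult_ac)
  also have "\<dots> \<in> Z"
  proof (intro cpoly.subspace_sum Z)
    fix s t assume st: "s \<in> {..expdeg \<beta> div 2}" "t \<in> {..expdeg \<gamma> div 2}"
    then have "2 * (s + t) + (expdeg \<beta> - 2 * s) + (expdeg \<gamma> - 2 * t) = n"
      using \<alpha>(4) by auto
    then show "norm_sq U ^ s * (norm_sq V ^ t * (H s * G t)) \<in> Z"
      using H(1) G(1) st by (intro mem) auto
  qed
  finally show ?case .
qed (use Z cpoly.subspace_add cpoly.subspace_0 in auto)

section \<open>Projections of products of harmonic polynomials\<close>

context
  fixes S Q k i
  assumes S: "S \<in> harm_hom U k" and Q: "Q \<in> harm_hom V i"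
begin

lemma S_polys: "S \<in> polys U" "homogeneous k S" and Q_polys: "Q \<in> polys V" "homogeneous i Q"
  using S Q by (auto simp: harm_hom_def harm_def)

lemma solid_product_U: "solid U k (S * Q)"
proof -
  have "solid U k (Q * S)"
    using disjoint by (intro solid_mult_left pd_eq_0[OF Q_polys(1)] solid_harm_hom[OF fin(1) S]) auto
  then show ?thesis by (simp add: mult.commute)
qed

lemma solid_product_V: "solid V i (S * Q)"
  using disjoint by (intro solid_mult_left pd_eq_0[OF S_polys(1)] solid_harm_hom[OF fin(2) Q]) auto

lemma product_polys: "S * Q \<in> polys W" "homogeneous (k + i) (S * Q)"
  using S_polys Q_polys polys_mono subset_W by (blast intro: polys_mult homogeneous_mult)+

lemma harm_proj_product:
  fixes s
  assumes "S \<noteq> 0" "Q \<noteq> 0"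
  shows "\<exists>c. harm_proj W (norm_sq U ^ s * (S * Q))
      = (\<Sum>a\<le>s. single 0 (c a) * (norm_sq U ^ a * (norm_sq V ^ (s - a) * (S * Q))))"
    and "harm_proj W (norm_sq U ^ s * (S * Q)) \<noteq> 0"
    and "harm_proj W (norm_sq U ^ s * (S * Q)) \<in> harm_hom W (2 * s + k + i)"
    and "\<exists>G\<in>polys W. norm_sq U ^ s * (S * Q) = harm_proj W (norm_sq U ^ s * (S * Q)) + norm_sq W * G"
proof -
  have nz: "S * Q \<noteq> 0" using assms by simp
  note * = harm_proj_norm_sq_power[OF solid_product_U solid_product_V product_polys nz, of s,
      folded add.assoc]
  show "\<exists>c. harm_proj W (norm_sq U ^ s * (S * Q))
      = (\<Sum>a\<le>s. single 0 (c a) * (norm_sq U ^ a * (norm_sq V ^ (s - a) * (S * Q))))"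
    by (rule *) (rule exI)
  show "harm_proj W (norm_sq U ^ s * (S * Q)) \<noteq> 0"
    and "harm_proj W (norm_sq U ^ s * (S * Q)) \<in> harm_hom W (2 * s + k + i)"
    and "\<exists>G\<in>polys W. norm_sq U ^ s * (S * Q) = harm_proj W (norm_sq U ^ s * (S * Q)) + norm_sq W * G"
    by (rule *, assumption)+
qed

text \<open>Rotations within u or within v see only the factor \<open>S * Q\<close>; for
  \<open>W\<close> the eigenvalue comes from harmonicity and the degree.\<close>

lemma laplace_beltrami_harm_proj:
  fixes s
  assumes "S \<noteq> 0" "Q \<noteq> 0"
  defines "B \<equiv> harm_proj W (norm_sq U ^ s * (S * Q))"
  shows "laplace_beltrami U B = of_int (LB_eigenvalue (card U) k) * B"
    and "laplace_beltrami V B = of_int (LB_eigenvalue (card V) i) * B"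
    and "laplace_beltrami W B = of_int (LB_eigenvalue (card W) (2 * s + k + i)) * B"
proof -
  obtain c where B: "B = (\<Sum>a\<le>s. single 0 (c a) * (norm_sq U ^ a * (norm_sq V ^ (s - a) * (S * Q))))"
    using harm_proj_product(1)[OF assms(1,2), of s, folded B_def] by (rule exE)
  have hom: "B \<in> harm_hom W (2 * s + k + i)"
    unfolding B_def by (rule harm_proj_product(3)[OF assms(1,2)])
  \<comment> \<open>The factor of the projection that is invariant under rotations of u and of
    v.\<close>
  define G where "G = (\<Sum>a\<le>s. single 0 (c a) * (norm_sq U ^ a * norm_sq V ^ (s - a)))"
  have BG: "B = G * (S * Q)" by (simp add: B G_def sum_distrib_right mult.assoc)
  have const: "angular a b (single 0 d) = 0" for a b d by (simp add: angular_def)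
  have G: "angular a b G = 0" if "a \<in> U \<and> b \<in> U \<or> a \<in> V \<and> b \<in> V" for a b
  proof -
    have "angular a b (norm_sq U) = 0" "angular a b (norm_sq V) = 0"
      by (rule angular_norm_sq; use fin that disjoint in blast)+
    then show ?thesis by (simp add: G_def angular_sum angular_mult angular_power const)
  qed
  show "laplace_beltrami U B = of_int (LB_eigenvalue (card U) k) * B"
    unfolding BG using G laplace_beltrami_solid[OF fin(1) solid_product_U]
    by (simp add: laplace_beltrami_mult_left mult.left_commute)
  show "laplace_beltrami V B = of_int (LB_eigenvalue (card V) i) * B"
    unfolding BG using G laplace_beltrami_solid[OF fin(2) solid_product_V]
    by (simp add: laplace_beltrami_mult_left mult.left_commute)
  show "laplace_beltrami W B = of_int (LB_eigenvalue (card W) (2 * s + k + i)) * B"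
    by (rule laplace_beltrami_solid[OF finite_W solid_harm_hom[OF finite_W hom]])
qed

end

text \<open>Each term is a u-part times a v-part, so Fischer products of terms factor. Powers of
  |u|^2 or |v|^2 preserve the orthogonality of the harmonic factors whatever the exponents, hence s
  and t may differ.\<close>

lemma harm_proj_orthogonal:
  assumes S: "S \<in> harm_hom U k" "S' \<in> harm_hom U k'" "S \<noteq> 0" "S' \<noteq> 0"
    and Q: "Q \<in> harm_hom V i" "Q' \<in> harm_hom V i'" "Q \<noteq> 0" "Q' \<noteq> 0"
    and orth: "fischer S S' = 0 \<or> fischer Q Q' = 0"
  shows "fischer (harm_proj W (norm_sq U ^ s * (S * Q))) (harm_proj W (norm_sq U ^ t * (S' * Q'))) = 0"
proof -
  have term_0: "fischer (norm_sq U ^ a * (norm_sq V ^ b * (S * Q))) (norm_sq U ^ c * (norm_sq V ^ d * (S' * Q'))) = 0"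
    for a b c d
  proof -
    have "fischer (norm_sq U ^ a * S) (norm_sq U ^ c * S') = 0 \<or>
        fischer (norm_sq V ^ b * Q) (norm_sq V ^ d * Q') = 0"
      using orth fischer_norm_sq_power[OF fin(1)] fischer_norm_sq_power[OF fin(2)]
        solid_harm_hom[OF fin(1)] solid_harm_hom[OF fin(2)] S Q by blast
    moreover have "fischer ((norm_sq U ^ a * S) * (norm_sq V ^ b * Q)) ((norm_sq U ^ c * S') * (norm_sq V ^ d * Q'))
      = fischer (norm_sq U ^ a * S) (norm_sq U ^ c * S') * fischer (norm_sq V ^ b * Q) (norm_sq V ^ d * Q')"
      using S Q by (intro fischer_mult_disjoint[OF disjoint] polys_mult polys_power)
        (auto simp: harm_hom_def harm_def)
    moreover have "norm_sq U ^ a * (norm_sq V ^ b * (S * Q)) = (norm_sq U ^ a * S) * (norm_sq V ^ b * Q)"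
      "norm_sq U ^ c * (norm_sq V ^ d * (S' * Q')) = (norm_sq U ^ c * S') * (norm_sq V ^ d * Q')"
      by (simp_all only: mult_ac)
    ultimately show ?thesis by (metis mult_zero_left mult_zero_right)
  qed
  obtain c where c: "harm_proj W (norm_sq U ^ s * (S * Q))
      = (\<Sum>a\<le>s. single 0 (c a) * (norm_sq U ^ a * (norm_sq V ^ (s - a) * (S * Q))))"
    using harm_proj_product(1)[OF S(1) Q(1) S(3) Q(3), of s] by (rule exE)
  obtain d where d: "harm_proj W (norm_sq U ^ t * (S' * Q'))
      = (\<Sum>a\<le>t. single 0 (d a) * (norm_sq U ^ a * (norm_sq V ^ (t - a) * (S' * Q'))))"
    using harm_proj_product(1)[OF S(2) Q(2) S(4) Q(4), of t] by (rule exE)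
  show ?thesis
    unfolding c d fischer_sum_left fischer_sum_right fischer_const_mult_left
      fischer_const_mult_right term_0 by simp
qed

end

section \<open>The orthogonal basis\<close>

text \<open>Different degrees are orthogonal by homogeneity, so bases chosen degree by degree form
  one orthogonal family.\<close>

lemma orthonormal_bases_orthogonal:
  assumes "\<And>k. orthonormal_basis (S k) (L k) (harm_hom V k)"
    and "l \<in> L k" "l' \<in> L k'" "(k, l) \<noteq> (k', l')"
  shows "fischer (S k l) (S k' l') = 0"
proof (cases "k = k'")
  case True
  then show ?thesis using assms
    unfolding orthonormal_basis_def orthogonal_basis_def orthogonal_family_def by auto
next
  case False
  have "S k l \<in> harm_hom V k" if "l \<in> L k" for k l
    using assms(1)[of k] that cpoly.span_base
    unfolding orthonormal_basis_def orthogonal_basis_def basis_family_def by blast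
  then have "homogeneous k (S k l)" "homogeneous k' (S k' l')"
    using assms(2,3) by (auto simp: harm_hom_def)
  then show ?thesis using False fischer_homogeneous by blast
qed

text \<open>The eigenvalue is a quadratic in k, so the only other coincidence is the reflection of k
  to 2 - d - k. For d \<ge> 1 and k different from k' this means d = 1 and the degrees 0 and
  1.\<close>

lemma LB_eigenvalue_eq_iff:
  "LB_eigenvalue d k = LB_eigenvalue d k' \<longleftrightarrow> k = k' \<or> k + k' + d = 2"
proof -
  have "LB_eigenvalue d k' - LB_eigenvalue d k = (int k - int k') * (int k + int k' + int d - 2)"
    by (simp add: LB_eigenvalue_def algebra_simps)
  then have "LB_eigenvalue d k = LB_eigenvalue d k' \<longleftrightarrow>
      int k - int k' = 0 \<or> int k + int k' + int d - 2 = 0"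
    by (metis eq_iff_diff_eq_0 mult_eq_0_iff)
  then show ?thesis by linarith
qed

text \<open>Since p + q \<ge> 2, the third eigenvalue fixes the total degree. What remains is a
  possible exchange of 0 and 1 in a one-dimensional factor.\<close>

lemma inj_LB_eigenvalues:
  assumes "p \<ge> 1" "q \<ge> 1" "\<not> (p = 1 \<and> q = 1)"
  shows "inj (\<lambda>(s, k, i). (LB_eigenvalue p k, LB_eigenvalue q i, LB_eigenvalue (p + q) (2 * s + k + i)))"
proof (rule injI)
  fix x y :: "nat \<times> nat \<times> nat"
  assume eq: "(case x of (s, k, i) \<Rightarrow> (LB_eigenvalue p k, LB_eigenvalue q i, LB_eigenvalue (p + q) (2 * s + k + i)))
    = (case y of (s, k, i) \<Rightarrow> (LB_eigenvalue p k, LB_eigenvalue q i, LB_eigenvalue (p + q) (2 * s + k + i)))"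
  obtain s k i where x: "x = (s, k, i)" by (rule prod_cases3)
  obtain s' k' i' where y: "y = (s', k', i')" by (rule prod_cases3)
  from eq have "LB_eigenvalue p k = LB_eigenvalue p k'" "LB_eigenvalue q i = LB_eigenvalue q i'"
    "LB_eigenvalue (p + q) (2 * s + k + i) = LB_eigenvalue (p + q) (2 * s' + k' + i')"
    unfolding x y by simp_all
  then have kis: "k = k' \<or> k + k' + p = 2" "i = i' \<or> i + i' + q = 2" "2 * s + k + i = 2 * s' + k' + i'"
    using assms unfolding LB_eigenvalue_eq_iff by linarith+
  have "k = k' \<or> p = 1 \<and> k + k' = 1" using kis(1) assms(1) by linarith
  moreover have "i = i' \<or> q = 1 \<and> i + i' = 1" using kis(2) assms(2) by linarith
  ultimately consider "k = k'" "i = i'" | "k = k'" "i + i' = 1" | "k + k' = 1" "i = i'"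
    using assms(3) by blast
  \<comment> \<open>A change in exactly one of k and i would change the parity of 2s + k +
    i.\<close>
  then have "s = s' \<and> k = k' \<and> i = i'" using kis(3) by cases presburger+
  then show "x = y" using x y by simp
qed

context orthogonal_split
begin

text \<open>Modulo \<open>norm_sq W\<close> one has \<open>norm_sq V = - norm_sq U\<close>, so every member of the
  double Fischer decomposition is congruent to a multiple of a projected one.\<close>

lemma span_harm_proj:
  assumes S: "\<And>k. harm_hom U k = cpoly.span (S k ` L k)" "\<And>k l. l \<in> L k \<Longrightarrow> S k l \<noteq> 0"
    and Q: "\<And>i. harm_hom V i = cpoly.span (Q i ` M i)" "\<And>i j. j \<in> M i \<Longrightarrow> Q i j \<noteq> 0"
  shows "cpoly.span {harm_proj W (norm_sq U ^ s * (S k l * Q i j)) | s k i l j.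
      2 * s + k + i = n \<and> l \<in> L k \<and> j \<in> M i} = harm_hom W n" (is "cpoly.span ?B = _")
proof
  have S_mem: "S k l \<in> harm_hom U k" if "l \<in> L k" for k l
    using that by (auto simp: S(1) intro: cpoly.span_base)
  have Q_mem: "Q i j \<in> harm_hom V i" if "j \<in> M i" for i j
    using that by (auto simp: Q(1) intro: cpoly.span_base)
  show B_sub: "cpoly.span ?B \<subseteq> harm_hom W n"
  proof (rule cpoly.span_minimal[OF _ subspace_harm_hom], clarify)
    fix s k i l j assume "l \<in> L k" "j \<in> M i"
    then show "harm_proj W (norm_sq U ^ s * (S k l * Q i j)) \<in> harm_hom W (2 * s + k + i)"
      by (intro harm_proj_product(3) S_mem Q_mem S(2) Q(2))
  qed
  \<comment> \<open>The span enlarged by all multiples of |x|^2, so that one can compute modulo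
    |x|^2 inside a subspace.\<close>
  define Z where "Z = {b + norm_sq W * G | b G. b \<in> cpoly.span ?B \<and> G \<in> polys W}"
  have Z: "cpoly.subspace Z"
  proof (rule cpoly.subspaceI)
    show "0 \<in> Z" unfolding Z_def
      by (intro CollectI exI[of _ 0]) (simp add: cpoly.span_zero)
    fix x y assume "x \<in> Z" "y \<in> Z"
    then obtain b G b' G' where "x = b + norm_sq W * G" "y = b' + norm_sq W * G'"
      "b \<in> cpoly.span ?B" "b' \<in> cpoly.span ?B" "G \<in> polys W" "G' \<in> polys W"
      unfolding Z_def by blast
    then show "x + y \<in> Z" unfolding Z_def
      by (intro CollectI exI[of _ "b + b'"] exI[of _ "G + G'"])
        (simp add: algebra_simps cpoly.span_add polys_add)
  next
    fix c x assume "x \<in> Z"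
    then obtain b G where x: "x = b + norm_sq W * G" and b: "b \<in> cpoly.span ?B" and G: "G \<in> polys W"
      unfolding Z_def by blast
    have "cscale c x = cscale c b + norm_sq W * cscale c G"
      by (simp add: x cscale_def distrib_left mult.left_commute)
    moreover have "cscale c b \<in> cpoly.span ?B" using b by (rule cpoly.span_scale)
    moreover have "cscale c G \<in> polys W" using G by (simp add: cscale_def polys_mult)
    ultimately show "cscale c x \<in> Z" unfolding Z_def by blast
  qed
  have basis: "norm_sq U ^ a * (norm_sq V ^ b * (S k l * Q i j)) \<in> Z"
    if l: "l \<in> L k" and j: "j \<in> M i" and n: "2 * (a + b) + k + i = n" for a b k i l j
  proof -
    let ?T = "S k l * Q i j" and ?c = "single 0 ((-1) ^ b) :: cpoly"
    define B where "B = harm_proj W (norm_sq U ^ (a + b) * ?T)"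
    obtain G where G: "G \<in> polys W" "norm_sq V ^ b = ?c * norm_sq U ^ b + norm_sq W * G"
      using norm_sq_V_power_cong by blast
    obtain K where K: "K \<in> polys W" "norm_sq U ^ (a + b) * ?T = B + norm_sq W * K"
      using harm_proj_product(4)[OF S_mem[OF l] Q_mem[OF j] S(2)[OF l] Q(2)[OF j]]
      unfolding B_def by (rule bexE)
    have T: "?T \<in> polys W" by (rule product_polys[OF S_mem[OF l] Q_mem[OF j]])
    \<comment> \<open>Trade |v|^(2b) for (-1)^b |u|^(2b), then |u|^(2(a+b)) T for its projection,
      both modulo |x|^2.\<close>
    have "norm_sq U ^ a * (norm_sq V ^ b * ?T)
        = ?c * (norm_sq U ^ (a + b) * ?T) + norm_sq W * (norm_sq U ^ a * (G * ?T))"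
      unfolding G(2) power_add by (simp only: distrib_left distrib_right mult_ac)
    also have "\<dots> = ?c * B + norm_sq W * (?c * K + norm_sq U ^ a * (G * ?T))"
      unfolding K(2) by (simp only: distrib_left distrib_right mult_ac add.assoc)
    finally have eq: "norm_sq U ^ a * (norm_sq V ^ b * ?T)
        = ?c * B + norm_sq W * (?c * K + norm_sq U ^ a * (G * ?T))" .
    have "B \<in> ?B" unfolding B_def using l j n by blast
    then have "cscale ((-1) ^ b) B \<in> cpoly.span ?B"
      by (intro cpoly.span_scale cpoly.span_base)
    then have "?c * B \<in> cpoly.span ?B" by (simp only: cscale_def)
    moreover have "?c * K + norm_sq U ^ a * (G * ?T) \<in> polys W"
      using polys_mult[OF G(1) T] K(1) subset_W
      by (intro polys_add polys_mult[of _ W K] polys_mult[of "norm_sq U ^ a"] polys_power) auto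
    ultimately show ?thesis unfolding Z_def eq by blast
  qed
  have product: "norm_sq U ^ a * (norm_sq V ^ b * (x * y)) \<in> Z"
    if x: "x \<in> harm_hom U k" and y: "y \<in> harm_hom V i" and n: "2 * (a + b) + k + i = n" for a b k i x y
  proof -
    \<comment> \<open>Bilinear extension: first in the second factor with a basis element fixed in
      the first, then in the first.\<close>
    have left: "norm_sq U ^ a * (norm_sq V ^ b * (S k l * y)) \<in> Z" if l: "l \<in> L k" for l
    proof -
      have "cpoly.span (Q i ` M i) \<subseteq> {y. (norm_sq U ^ a * norm_sq V ^ b * S k l) * y \<in> Z}"
        by (rule cpoly.span_minimal[OF _ subspace_mult_left[OF Z]])
          (use basis[OF l _ n] in \<open>auto simp: mult.assoc\<close>)
      then show ?thesis using y unfolding Q(1) by (auto simp: mult.assoc)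
    qed
    have "cpoly.span (S k ` L k) \<subseteq> {x. (norm_sq U ^ a * norm_sq V ^ b * y) * x \<in> Z}"
      by (rule cpoly.span_minimal[OF _ subspace_mult_left[OF Z]])
        (use left in \<open>auto simp: mult_ac\<close>)
    then show ?thesis using x unfolding S(1) by (auto simp: mult_ac)
  qed
  show "harm_hom W n \<subseteq> cpoly.span ?B"
  proof
    fix f assume f: "f \<in> harm_hom W n"
    then have "f \<in> Z"
      by (intro homogeneous_in_subspace[OF _ _ Z product, of f n])
        (auto simp: harm_hom_def harm_def)
    then obtain b G where b: "b \<in> cpoly.span ?B" "f = b + norm_sq W * G"
      unfolding Z_def by blast
    \<comment> \<open>Both are harmonic and they agree modulo |x|^2, so the remainder
      disappears.\<close>
    have "f = b"
      using f b B_sub by (intro harm_eqI[of f W b 0 G]) (auto simp: harm_hom_def)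
    then show "f \<in> cpoly.span ?B" using b(1) by simp
  qed
qed

end

theorem theorem6:
  fixes p q m n :: nat
    and S Q :: "nat \<Rightarrow> nat \<Rightarrow> cpoly"
  defines "U \<equiv> {1..p}" and "V \<equiv> {p+1..m}" and "W \<equiv> {1..m}"
  defines "B \<equiv> \<lambda>(s, k, i, l, j). harm_proj W (norm_sq U ^ s * S k l * Q i j)"
    and "I \<equiv> {(s, k, i, l, j). 2 * s + k + i = n \<and>
                l \<in> {1..cpoly.dim (harm_hom U k)} \<and> j \<in> {1..cpoly.dim (harm_hom V i)}}"
  assumes "p \<ge> 1" and "q \<ge> 1" and "m = p + q"
    and "\<And>k. orthonormal_basis (S k) {1..cpoly.dim (harm_hom U k)} (harm_hom U k)"
    and "\<And>i. orthonormal_basis (Q i) {1..cpoly.dim (harm_hom V i)} (harm_hom V i)"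
  shows "orthogonal_basis B I (harm_hom W n)
    \<and> commute_on (polys W) (laplace_beltrami U) (laplace_beltrami V)
    \<and> commute_on (polys W) (laplace_beltrami U) (laplace_beltrami W)
    \<and> commute_on (polys W) (laplace_beltrami V) (laplace_beltrami W)
    \<and> (\<forall>(s, k, i, l, j) \<in> I.
         eigenfunction (laplace_beltrami U) (LB_eigenvalue p k) (B (s, k, i, l, j)) \<and>
         eigenfunction (laplace_beltrami V) (LB_eigenvalue q i) (B (s, k, i, l, j)) \<and>
         eigenfunction (laplace_beltrami W) (LB_eigenvalue m (2 * s + k + i)) (B (s, k, i, l, j)) \<and>
         LB_eigenvalue m (2 * s + k + i) = LB_eigenvalue m n)
    \<and> (\<not> (p = 1 \<and> q = 1) \<longrightarrow>
         inj (\<lambda>(s, k, i). (LB_eigenvalue p k, LB_eigenvalue q i, LB_eigenvalue m (2 * s + k + i))))"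
proof -
  interpret orthogonal_split U V W
    by unfold_locales (use assms(6-8) in \<open>auto simp: U_def V_def W_def\<close>)
  have card: "card U = p" "card V = q" "card W = m"
    using assms(8) by (simp_all add: U_def V_def W_def)
  define L where "L k = {1..cpoly.dim (harm_hom U k)}" for k
  define M where "M i = {1..cpoly.dim (harm_hom V i)}" for i
  have bases: "orthonormal_basis (S k) (L k) (harm_hom U k)" "orthonormal_basis (Q k) (M k) (harm_hom V k)" for k
    unfolding L_def M_def by (fact assms(9,10))+
  have S_span: "harm_hom U k = cpoly.span (S k ` L k)" and Q_span: "harm_hom V k = cpoly.span (Q k ` M k)" for k
    using bases[of k] by (auto simp: orthonormal_basis_def orthogonal_basis_def basis_family_def)
  \<comment> \<open>A zero element would have Fischer square 0 instead of 1.\<close>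
  have S_nz: "S k l \<noteq> 0" if "l \<in> L k" for k l
    using bases(1)[of k] that unfolding orthonormal_basis_def by fastforce
  have Q_nz: "Q k l \<noteq> 0" if "l \<in> M k" for k l
    using bases(2)[of k] that unfolding orthonormal_basis_def by fastforce
  have S_mem: "S k l \<in> harm_hom U k" if "l \<in> L k" for k l
    using that by (auto simp: S_span intro: cpoly.span_base)
  have Q_mem: "Q k l \<in> harm_hom V k" if "l \<in> M k" for k l
    using that by (auto simp: Q_span intro: cpoly.span_base)
  have B: "B (s, k, i, l, j) = harm_proj W (norm_sq U ^ s * (S k l * Q i j))" for s k i l j
    by (simp add: B_def mult.assoc)
  have I: "(s, k, i, l, j) \<in> I \<longleftrightarrow> 2 * s + k + i = n \<and> l \<in> L k \<and> j \<in> M i" for s k i l j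
    by (simp add: I_def L_def M_def)
  have B_nz: "B (s, k, i, l, j) \<noteq> 0" if "l \<in> L k" "j \<in> M i" for s k i l j
    unfolding B
    by (rule harm_proj_product(2)[OF S_mem[OF that(1)] Q_mem[OF that(2)] S_nz[OF that(1)] Q_nz[OF that(2)]])

  have orth: "orthogonal_family B I"
    unfolding orthogonal_family_def
  proof (intro ballI impI)
    fix x y assume xy: "x \<in> I" "y \<in> I" "x \<noteq> y"
    obtain s k i l j s' k' i' l' j' where eq: "x = (s, k, i, l, j)" "y = (s', k', i', l', j')"
      by (metis prod_cases5)
    have mem: "l \<in> L k" "j \<in> M i" "l' \<in> L k'" "j' \<in> M i'" "2 * s + k + i = 2 * s' + k' + i'"
      using xy(1,2) unfolding eq I by auto
    \<comment> \<open>The total degree is fixed, so k and i determine s; distinct labels already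
      differ in one of the two harmonic factors.\<close>
    then have "(k, l) \<noteq> (k', l') \<or> (i, j) \<noteq> (i', j')"
      using xy(3) unfolding eq by auto
    then have "fischer (S k l) (S k' l') = 0 \<or> fischer (Q i j) (Q i' j') = 0"
      using mem orthonormal_bases_orthogonal[of S L U l k l' k', OF bases(1)]
        orthonormal_bases_orthogonal[of Q M V j i j' i', OF bases(2)] by blast
    then show "fischer (B x) (B y) = 0"
      unfolding eq B
      by (rule harm_proj_orthogonal[OF S_mem[OF mem(1)] S_mem[OF mem(3)] S_nz[OF mem(1)] S_nz[OF mem(3)]
            Q_mem[OF mem(2)] Q_mem[OF mem(4)] Q_nz[OF mem(2)] Q_nz[OF mem(4)]])
  qed
  have image: "B ` I = {harm_proj W (norm_sq U ^ s * (S k l * Q i j)) | s k i l j.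
      2 * s + k + i = n \<and> l \<in> L k \<and> j \<in> M i}"
    unfolding B[symmetric] I[symmetric] by (auto simp: image_iff) (metis prod_cases5)+
  have "cpoly.span (B ` I) = harm_hom W n"
    unfolding image by (rule span_harm_proj) (fact S_span S_nz Q_span Q_nz)+
  moreover have nz: "B x \<noteq> 0" if "x \<in> I" for x
    using that B_nz I by (cases x) auto
  ultimately have "orthogonal_basis B I (harm_hom W n)"
    using orth orthogonal_family_independent[OF orth nz]
    by (simp add: orthogonal_basis_def basis_family_def)
  moreover have "commute_on (polys W) (laplace_beltrami U) (laplace_beltrami V)"
    "commute_on (polys W) (laplace_beltrami U) (laplace_beltrami W)"
    "commute_on (polys W) (laplace_beltrami V) (laplace_beltrami W)"
    using laplace_beltrami_commute fin finite_W disjoint subset_W by (auto simp: commute_on_def)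
  moreover have "\<forall>(s, k, i, l, j) \<in> I.
         eigenfunction (laplace_beltrami U) (LB_eigenvalue p k) (B (s, k, i, l, j)) \<and>
         eigenfunction (laplace_beltrami V) (LB_eigenvalue q i) (B (s, k, i, l, j)) \<and>
         eigenfunction (laplace_beltrami W) (LB_eigenvalue m (2 * s + k + i)) (B (s, k, i, l, j)) \<and>
         LB_eigenvalue m (2 * s + k + i) = LB_eigenvalue m n"
  proof (safe)
    fix s k i l j assume "(s, k, i, l, j) \<in> I"
    then have mem: "l \<in> L k" "j \<in> M i" "2 * s + k + i = n" by (auto simp: I)
    note eig = laplace_beltrami_harm_proj[OF S_mem[OF mem(1)] Q_mem[OF mem(2)]
        S_nz[OF mem(1)] Q_nz[OF mem(2)], of s, folded B, unfolded card]
    show "eigenfunction (laplace_beltrami U) (LB_eigenvalue p k) (B (s, k, i, l, j))"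
      "eigenfunction (laplace_beltrami V) (LB_eigenvalue q i) (B (s, k, i, l, j))"
      "eigenfunction (laplace_beltrami W) (LB_eigenvalue m (2 * s + k + i)) (B (s, k, i, l, j))"
      using eig B_nz[OF mem(1,2)] by (simp_all add: eigenfunction_def cscale_def)
    show "LB_eigenvalue m (2 * s + k + i) = LB_eigenvalue m n" using mem(3) by simp
  qed
  moreover have "\<not> (p = 1 \<and> q = 1) \<longrightarrow>
         inj (\<lambda>(s, k, i). (LB_eigenvalue p k, LB_eigenvalue q i, LB_eigenvalue m (2 * s + k + i)))"
    using inj_LB_eigenvalues assms(6-8) by blast
  ultimately show ?thesis by blast
qed

end
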